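(* For a finite Coxeter group $W$ let $L_W(t)=\sum_{x\in W,\ x^2=1}t^{\ell(x)}$. For $n\ge 1$ let $$L_{(B\setminus D)_n}(t)=\sum_{x}t^{|\Lambda(x)|},$$ the sum being over all $x\in W(B_n)\setminus W(D_n)$ with $x^2=1$, where $\Lambda(x)$ is the set of $\alpha\in\{e_j-e_i,\ e_j+e_i:1\le i<j\le n\}$ with $x\cdot\alpha<0$. (a) $L_{W(A_1)}(t)=1+t$, $L_{W(A_2)}(t)=1+2t+t^3$, and for $n\ge 3$, $$L_{W(A_n)}(t)=L_{W(A_{n-1})}(t)+\frac{t(t^{2n}-1)}{t^2-1}L_{W(A_{n-2})}(t).$$ (b) $L_{W(B_1)}(t)=1+t$, $L_{W(B_2)}(t)=1+2t+2t^3+t^4$, and for $n\ge 3$, $$L_{W(B_n)}(t)=(1+t^{2n-1})L_{W(B_{n-1})}(t)+\frac{t(t^{4n-4}-1)}{t^2-1}L_{W(B_{n-2})}(t).$$ (c) $L_{W(D_1)}(t)=1$, $L_{(B\setminus D)_1}(t)=1$, $L_{W(D_2)}(t)=1+2t+t^2$, $L_{(B\setminus D)_2}(t)=1+t^2$, and for $n\ge 3$, $$L_{W(D_n)}(t)=L_{W(D_{n-1})}(t)+t^{2n-2}L_{(B\setminus D)_{n-1}}(t)+\frac{t(1+t^{2n-4})(t^{2n-2}-1)}{t^2-1}L_{W(D_{n-2})}(t)$$ and $$L_{(B\setminus D)_n}(t)=L_{(B\setminus D)_{n-1}}(t)+t^{2n-2}L_{W(D_{n-1})}(t)+\frac{t(1+t^{2n-4})(t^{2n-2}-1)}{t^2-1}L_{(B\setminus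 D)_{n-2}}(t).$$
   Context: $\ell$ is the Coxeter length: the least number of fundamental reflections in an expression for the element. $W(A_n)=\mathrm{Sym}(n+1)$ with fundamental reflections the adjacent transpositions. $W(B_n)$ ($n\ge 1$) is the group of signed permutations of $\{1,\dots,n\}$: bijections $w$ of $\{\pm1,\dots,\pm n\}$ with $w(-i)=-w(i)$, acting on $\mathbb{R}^n$ with orthonormal basis $e_1,\dots,e_n$ by $w\cdot e_i=e_{w(i)}$, where $e_{-i}=-e_i$; its positive roots are $e_j\pm e_i$ ($1\le i<j\le n$) and $e_i$ ($1\le i\le n$), with simple roots $e_1$ and $e_{i+1}-e_i$ ($1\le i<n$). $W(D_n)$ ($n\ge1$) is the subgroup of those $w\in W(B_n)$ for which the number of $i\in\{1,\dots,n\}$ with $w(i)<0$ is even; its positive roots are $e_j\pm e_i$ ($1\le i<j\le n$), with simple roots (for $n\ge2$) $e_1+e_2$ and $e_{i+1}-e_i$ ($1\le i<n$); $W(D_1)$ is trivial. The fundamental reflections are the reflections in the simple roots. A root $\alpha$ is written $\alpha<0$ if it is the negative of a positive root. The length of an element equals the number of positive roots (of the relevant type) it sends to negative roots. *)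

theory Defs
  imports
    "HOL-Algebra.Sym_Groups"
    "HOL-Computational_Algebra.Polynomial"
    "HOL-Computational_Algebra.Polynomial_Factorial"
    "HOL-Library.Function_Algebras"
begin

section \<open>Length and the involution polynomial of a group with chosen generators\<close>

text \<open>If \<open>S\<close> does not generate \<open>x\<close>, the value is unspecified.\<close>

definition word_length :: "('a, 'b) monoid_scheme \<Rightarrow> 'a set \<Rightarrow> 'a \<Rightarrow> nat" where
  "word_length G S x =
     (LEAST k. \<exists>ss. set ss \<subseteq> S \<and> length ss = k \<and> foldr (\<otimes>\<^bsub>G\<^esub>) ss \<one>\<^bsub>G\<^esub> = x)"

text \<open>The identity is included in the sum, since it satisfies \<open>x\<^sup>2 = 1\<close>.\<close>

definition inv_poly :: "('a, 'b) monoid_scheme \<Rightarrow> 'a set \<Rightarrow> int poly" where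
  "inv_poly G S =
     (\<Sum>x\<in>{x \<in> carrier G. x \<otimes>\<^bsub>G\<^esub> x = \<one>\<^bsub>G\<^esub>}. Polynomial.monom 1 (word_length G S x))"

section \<open>Type A\<close>

definition refls_A :: "nat \<Rightarrow> (nat \<Rightarrow> nat) set" where
  "refls_A n = {Transposition.transpose i (i + 1) | i. 1 \<le> i \<and> i \<le> n}"

definition L_A :: "nat \<Rightarrow> int poly" where
  "L_A n = inv_poly (sym_group (n + 1)) (refls_A n)"

section \<open>Signed permutations and their action\<close>

definition W_B :: "nat \<Rightarrow> (int \<Rightarrow> int) monoid" where
  "W_B n =
     \<lparr>carrier = {w. w permutes ({- int n..int n} - {0}) \<and> (\<forall>i. w (- i) = - w i)},
      monoid.mult = (\<circ>), one = id\<rparr>"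

definition W_D :: "nat \<Rightarrow> (int \<Rightarrow> int) monoid" where
  "W_D n = (W_B n)\<lparr>carrier := {w \<in> carrier (W_B n). even (card {i \<in> {1..int n}. w i < 0})}\<rparr>"

text \<open>
  Vectors in \<open>\<real>\<^sup>n\<close> are functions \<open>nat \<Rightarrow> real\<close> vanishing outside \<open>{1..n}\<close>.
  Basis vectors are indexed by integers so that \<open>bvec (- i) = - bvec i\<close>; also \<open>bvec 0 = 0\<close>.
\<close>

definition vecs :: "nat \<Rightarrow> (nat \<Rightarrow> real) set" where
  "vecs n = {v. \<forall>k. k \<notin> {1..n} \<longrightarrow> v k = 0}"

definition bvec :: "int \<Rightarrow> nat \<Rightarrow> real" where
  "bvec i = (\<lambda>k. if int k = \<bar>i\<bar> then of_int (sgn i) else 0)"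

definition act :: "nat \<Rightarrow> (int \<Rightarrow> int) \<Rightarrow> (nat \<Rightarrow> real) \<Rightarrow> nat \<Rightarrow> real" where
  "act n w v = (\<lambda>k. \<Sum>i=1..n. v i * bvec (w (int i)) k)"

definition ip :: "nat \<Rightarrow> (nat \<Rightarrow> real) \<Rightarrow> (nat \<Rightarrow> real) \<Rightarrow> real" where
  "ip n u v = (\<Sum>k=1..n. u k * v k)"

definition reflection :: "nat \<Rightarrow> (nat \<Rightarrow> real) \<Rightarrow> (nat \<Rightarrow> real) \<Rightarrow> nat \<Rightarrow> real" where
  "reflection n a v = (\<lambda>k. v k - 2 * ip n v a / ip n a a * a k)"

text \<open>The elements of \<open>G\<close> that act on \<open>\<real>\<^sup>n\<close> as the reflection in some vector of \<open>R\<close>.\<close>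

definition refls_in :: "nat \<Rightarrow> (int \<Rightarrow> int) monoid \<Rightarrow> (nat \<Rightarrow> real) set \<Rightarrow> (int \<Rightarrow> int) set" where
  "refls_in n G R = {s \<in> carrier G. \<exists>a\<in>R. \<forall>v\<in>vecs n. act n s v = reflection n a v}"

section \<open>Types B and D\<close>

definition pos_D :: "nat \<Rightarrow> (nat \<Rightarrow> real) set" where
  "pos_D n = {bvec j - bvec i | i j. 1 \<le> i \<and> i < j \<and> j \<le> int n}
           \<union> {bvec j + bvec i | i j. 1 \<le> i \<and> i < j \<and> j \<le> int n}"

definition pos_B :: "nat \<Rightarrow> (nat \<Rightarrow> real) set" where
  "pos_B n = pos_D n \<union> {bvec i | i. 1 \<le> i \<and> i \<le> int n}"

definition simple_B :: "nat \<Rightarrow> (nat \<Rightarrow> real) set" where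
  "simple_B n = {bvec 1} \<union> {bvec (i + 1) - bvec i | i. 1 \<le> i \<and> i < int n}"

definition simple_D :: "nat \<Rightarrow> (nat \<Rightarrow> real) set" where
  "simple_D n =
     (if n \<ge> 2
      then {bvec 1 + bvec 2} \<union> {bvec (i + 1) - bvec i | i. 1 \<le> i \<and> i < int n}
      else {})"

definition L_B :: "nat \<Rightarrow> int poly" where
  "L_B n = inv_poly (W_B n) (refls_in n (W_B n) (simple_B n))"

definition L_D :: "nat \<Rightarrow> int poly" where
  "L_D n = inv_poly (W_D n) (refls_in n (W_D n) (simple_D n))"

text \<open>
  Negativity is taken in the root system of type B, on which all of \<open>W_B n\<close> acts.
  Images of D-roots are D-roots, so using \<open>pos_D\<close> throughout would give the same set.
\<close>

definition Lam :: "nat \<Rightarrow> (int \<Rightarrow> int) \<Rightarrow> (nat \<Rightarrow> real) set" where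
  "Lam n x = {a \<in> pos_D n. - act n x a \<in> pos_B n}"

definition L_BD :: "nat \<Rightarrow> int poly" where
  "L_BD n =
     (\<Sum>x\<in>{x \<in> carrier (W_B n) - carrier (W_D n). x \<otimes>\<^bsub>W_B n\<^esub> x = \<one>\<^bsub>W_B n\<^esub>}.
        Polynomial.monom 1 (card (Lam n x)))"

abbreviation tvar :: "int poly" where
  "tvar \<equiv> [:0, 1:]"

end

(*
  All three types are treated as sums over signed involutions x of a finite set of positive integers.
  By counting sign changes of the roots e_j +- e_i, the numbers D_len x of these roots made negative
  and negs x of negative values x(i) (i > 0) determine everything: the length is D_len + negs in type B
  and D_len in type D (negs even), and Sym(n+1) consists of the signed permutations with negs = 0,
  where D_len counts inversions. For an arbitrary function f, the sum of f (D_len x) (negs x) over the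
  signed involutions is split according to the image k of the largest element m: if k = m or k = -m
  remove m, otherwise remove m and |k|. The effect on (D_len, negs) is a shift depending only on the
  sign and the rank of k, so the sum satisfies a recursion in the cardinality alone; specialising f
  gives all four recursions, the coefficients being geometric sums over the rank of |k|.
*)

theory Submission
  imports Defs
begin

section \<open>Lengths characterised by descents\<close>


text \<open>Deleting m and \<open>\<bar>k\<bar>\<close> from an interval leaves a gap, so everything
  is set up over an arbitrary finite set of positive integers. The weight f is arbitrary because
  each deletion replaces it by a shifted copy, and the induction must cover these copies too. The
  shift of \<open>negs\<close> explains the shape of the recursions: the image -m moves it by 1,
  which exchanges even and odd and couples D with its complement in B; a negative image k other than
  -m moves it by 2, which keeps the parity but costs an extra factor t^2 in type B. Hence the
  geometric sum in t^2 carries the factor 1 + t^(2n-4) in type D and 1 + t^(2n-2) in type B, where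
  (t^(2n-2) - 1)(1 + t^(2n-2)) = t^(4n-4) - 1 gives the stated form. Since length is defined by
  shortest words, the root counts must be identified with it: a statistic that vanishes at the
  identity, grows by at most 1 under each generator and drops under some involutive generator at
  every other element is the length.\<close>

lemma word_length_eqI:
  assumes "monoid G" and S: "S \<subseteq> carrier G" and x: "x \<in> carrier G"
    and one: "l \<one>\<^bsub>G\<^esub> = 0"
    and step: "\<And>x s. x \<in> carrier G \<Longrightarrow> s \<in> S \<Longrightarrow> l (x \<otimes>\<^bsub>G\<^esub> s) \<le> Suc (l x)"
    and descent: "\<And>x. x \<in> carrier G \<Longrightarrow> x \<noteq> \<one>\<^bsub>G\<^esub> \<Longrightarrow>
      \<exists>s\<in>S. s \<otimes>\<^bsub>G\<^esub> s = \<one>\<^bsub>G\<^esub> \<and> l (x \<otimes>\<^bsub>G\<^esub> s) < l x"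
  shows "word_length G S x = l x"
proof -
  interpret monoid G by fact
  define W where "W ss = foldr (\<otimes>\<^bsub>G\<^esub>) ss \<one>\<^bsub>G\<^esub>" for ss
  \<comment> \<open>A \<open>foldr\<close> word grows at its left end while the hypotheses multiply
    on the right; factoring out the start value lets a generator be appended at the end.\<close>
  have foldr: "foldr (\<otimes>\<^bsub>G\<^esub>) ss y = W ss \<otimes>\<^bsub>G\<^esub> y \<and> W ss \<in> carrier G"
    if "set ss \<subseteq> S" "y \<in> carrier G" for ss y
    using that S by (induction ss) (auto simp: W_def m_assoc)
  have W_append: "W (ss @ [s]) = W ss \<otimes>\<^bsub>G\<^esub> s" if "set ss \<subseteq> S" "s \<in> S" for ss s
    using foldr[of ss s] that S by (auto simp: W_def)
  have lower: "l (W ss) \<le> length ss" if "set ss \<subseteq> S" for ss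
    using that
  proof (induction ss rule: rev_induct)
    case (snoc s ss)
    then show ?case
      using step[of "W ss" s] foldr[of ss "\<one>\<^bsub>G\<^esub>"] by (auto simp: W_append)
  qed (simp add: W_def one)
  have upper: "\<exists>ss. set ss \<subseteq> S \<and> length ss \<le> l x \<and> W ss = x" if "x \<in> carrier G" for x
    using that
  proof (induction "l x" arbitrary: x rule: less_induct)
    case less
    show ?case
    proof (cases "x = \<one>\<^bsub>G\<^esub>")
      case True
      then show ?thesis by (intro exI[of _ "[]"]) (simp add: W_def)
    next
      case False
      \<comment> \<open>Since s squares to one, a short word for the product of x and s, followed by
        s, spells x.\<close>
      from descent[OF less.prems this] obtain s
        where s: "s \<in> S" "s \<otimes>\<^bsub>G\<^esub> s = \<one>\<^bsub>G\<^esub>" "l (x \<otimes>\<^bsub>G\<^esub> s) < l x" by blast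
      have sc: "s \<in> carrier G" using s S by blast
      from less.hyps[OF s(3)] sc less.prems obtain ss
        where ss: "set ss \<subseteq> S" "length ss \<le> l (x \<otimes>\<^bsub>G\<^esub> s)" "W ss = x \<otimes>\<^bsub>G\<^esub> s" by blast
      have "W (ss @ [s]) = x"
        using ss s sc less.prems by (simp add: W_append m_assoc)
      then show ?thesis using ss s by (intro exI[of _ "ss @ [s]"]) auto
    qed
  qed
  obtain ss where ss: "set ss \<subseteq> S" "length ss \<le> l x" "W ss = x" using upper[OF x] by blast
  have "length ss = l x" using lower[OF ss(1)] ss by simp
  then show ?thesis
    unfolding word_length_def
    using ss lower by (fold W_def, intro Least_equality) (auto, metis)
qed

section \<open>Signed permutations\<close>

definition signed :: "int set \<Rightarrow> (int \<Rightarrow> int) set" where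
  "signed X = {w. w permutes (X \<union> uminus ` X) \<and> (\<forall>i. w (- i) = - w i)}"

definition signed_invs :: "int set \<Rightarrow> (int \<Rightarrow> int) set" where
  "signed_invs X = {w \<in> signed X. w \<circ> w = id}"

text \<open>If \<open>w i = p\<close>, \<open>w j = q\<close> and \<open>\<bar>p\<bar> \<noteq> \<bar>q\<bar>\<close>, this is the number of negative roots among the
  images \<open>e\<^sub>q - e\<^sub>p\<close> and \<open>e\<^sub>q + e\<^sub>p\<close> of \<open>e\<^sub>j - e\<^sub>i\<close> and \<open>e\<^sub>j + e\<^sub>i\<close>.\<close>

definition D_neg :: "int \<Rightarrow> int \<Rightarrow> nat" where
  "D_neg p q = (if \<bar>p\<bar> < \<bar>q\<bar> then if q < 0 then 2 else 0 else 1)"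

definition D_len :: "int set \<Rightarrow> (int \<Rightarrow> int) \<Rightarrow> nat" where
  "D_len X w = (\<Sum>(a, b) | a \<in> X \<and> b \<in> X \<and> a < b. D_neg (w a) (w b))"

definition negs :: "int set \<Rightarrow> (int \<Rightarrow> int) \<Rightarrow> nat" where
  "negs X w = card {i \<in> X. w i < 0}"

lemma D_len_empty [simp]: "D_len {} w = 0"
  by (simp add: D_len_def)

lemma negs_empty [simp]: "negs {} w = 0"
  by (simp add: negs_def)

text \<open>k may lie anywhere relative to X, because both a maximum and an element in the middle
  get inserted. The order of a and k decides which argument of the asymmetric \<open>D_neg\<close>
  each supplies.\<close>

lemma D_len_insert:
  assumes "finite X" "k \<notin> X"
  shows "D_len (insert k X) w = D_len X w +
    (\<Sum>a\<in>X. if a < k then D_neg (w a) (w k) else D_neg (w k) (w a))"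
proof -
  define P where "P = {(a, b). a \<in> X \<and> b \<in> X \<and> a < b}"
  define h where "h = (\<lambda>a. (min a k, max a k))"
  have "{(a, b). a \<in> insert k X \<and> b \<in> insert k X \<and> a < b} = P \<union> h ` X"
  proof (intro equalityI subrelI, goal_cases)
    case (1 a b)
    then have "(a = k \<and> b \<in> X \<and> k < b) \<or> (b = k \<and> a \<in> X \<and> a < k) \<or> (a \<in> X \<and> b \<in> X)"
      by auto
    then consider "a = k" "b \<in> X" "k < b" | "b = k" "a \<in> X" "a < k" | "a \<in> X" "b \<in> X"
      by blast
    then show ?case
    proof cases
      case 1
      then have "(a, b) = h b" by (simp add: h_def)
      then show ?thesis using 1 by blast
    next
      case 2
      then have "(a, b) = h a" by (simp add: h_def)
      then show ?thesis using 2 by blast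
    qed (use 1 in \<open>auto simp: P_def\<close>)
  qed (use assms in \<open>auto simp: P_def h_def min_def max_def order_le_less split: if_splits\<close>)
  moreover have "P \<inter> h ` X = {}"
    using assms by (auto simp: P_def h_def min_def max_def split: if_splits)
  moreover have "finite P"
    by (rule finite_subset[of _ "X \<times> X"]) (use assms in \<open>auto simp: P_def\<close>)
  moreover have "inj_on h X"
    using assms by (auto simp: inj_on_def h_def min_def max_def split: if_splits)
  ultimately have "D_len (insert k X) w = D_len X w +
      (\<Sum>a\<in>X. case h a of (a, b) \<Rightarrow> D_neg (w a) (w b))"
    using assms by (simp add: D_len_def P_def[symmetric] sum.union_disjoint sum.reindex)
  moreover have "(case h a of (a, b) \<Rightarrow> D_neg (w a) (w b)) =
      (if a < k then D_neg (w a) (w k) else D_neg (w k) (w a))" if "a \<in> X" for a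
    using that assms by (auto simp: h_def min_def max_def)
  ultimately show ?thesis by simp
qed

lemma negs_insert:
  assumes "finite X" "k \<notin> X"
  shows "negs (insert k X) w = negs X w + (if w k < 0 then 1 else 0)"
proof -
  have "{i \<in> insert k X. w i < 0} =
      (if w k < 0 then insert k {i \<in> X. w i < 0} else {i \<in> X. w i < 0})" by auto
  then show ?thesis using assms by (simp add: negs_def)
qed

lemma D_len_cong: "(\<And>a. a \<in> X \<Longrightarrow> w a = w' a) \<Longrightarrow> D_len X w = D_len X w'"
  unfolding D_len_def by (rule sum.cong) auto

lemma negs_cong: "(\<And>a. a \<in> X \<Longrightarrow> w a = w' a) \<Longrightarrow> negs X w = negs X w'"
  unfolding negs_def by (metis (mono_tags, lifting) Collect_cong)

lemma in_pm_iff: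
  fixes X :: "int set"
  assumes "\<And>i. i \<in> X \<Longrightarrow> i > 0"
  shows "i \<in> X \<union> uminus ` X \<longleftrightarrow> \<bar>i\<bar> \<in> X"
proof -
  have "i \<in> uminus ` X \<longleftrightarrow> - i \<in> X" by force
  then show ?thesis using assms[of i] assms[of "- i"] by (auto simp: abs_if)
qed

lemma signedD:
  assumes "w \<in> signed X"
  shows "w permutes (X \<union> uminus ` X)" "w (- i) = - w i" "w i = w j \<longleftrightarrow> i = j" "w 0 = 0"
proof -
  show p: "w permutes (X \<union> uminus ` X)" and o: "w (- i) = - w i" for i
    using assms by (auto simp: signed_def)
  show "w i = w j \<longleftrightarrow> i = j"
    using p by (simp add: permutes_inj inj_eq)
  show "w 0 = 0" using o[of 0] by simp
qed

lemma signed_abs_eq_iff: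
  assumes "w \<in> signed X"
  shows "\<bar>w i\<bar> = \<bar>w j\<bar> \<longleftrightarrow> \<bar>i\<bar> = \<bar>j\<bar>"
  using signedD(2,3)[OF assms] by (metis abs_eq_iff)

lemma signed_eq_0_iff: "w \<in> signed X \<Longrightarrow> w i = 0 \<longleftrightarrow> i = 0"
  using signedD(3,4) by metis

lemma signed_abs_in:
  assumes "w \<in> signed X" "i \<in> X \<union> uminus ` X" "\<And>i. i \<in> X \<Longrightarrow> i > 0"
  shows "\<bar>w i\<bar> \<in> X"
proof -
  have "w i \<in> X \<union> uminus ` X"
    using permutes_in_image[OF signedD(1)[OF assms(1)]] assms(2) by blast
  then show ?thesis using in_pm_iff[OF assms(3)] by blast
qed

text \<open>This permutation of the absolute values turns sums over values into sums over
  positions.\<close>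

lemma signed_abs_bij:
  assumes "w \<in> signed X" "finite X" "\<And>i. i \<in> X \<Longrightarrow> i > 0"
  shows "bij_betw (\<lambda>i. \<bar>w i\<bar>) X X"
proof -
  have "inj_on (\<lambda>i. \<bar>w i\<bar>) X"
    using signed_abs_eq_iff[OF assms(1)] assms(3)
    by (intro inj_onI) (metis abs_of_pos)
  moreover have "(\<lambda>i. \<bar>w i\<bar>) ` X \<subseteq> X"
    using signed_abs_in[OF assms(1)] assms(3) by auto
  ultimately show ?thesis
    by (simp add: bij_betw_def assms(2) endo_inj_surj)
qed

lemma finite_signed: "finite X \<Longrightarrow> finite (signed X)"
  by (rule finite_subset[of _ "{w. w permutes (X \<union> uminus ` X)}"])
    (auto simp: signed_def finite_permutations)

lemma finite_signed_invs: "finite X \<Longrightarrow> finite (signed_invs X)"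
  using finite_signed by (auto simp: signed_invs_def)

section \<open>Signed involutions with a prescribed image of one element\<close>

lemma signed_invs_altdef:
  assumes "\<And>i. i \<in> X \<Longrightarrow> i > 0"
  shows "signed_invs X =
    {w. (\<forall>i. \<bar>i\<bar> \<notin> X \<longrightarrow> w i = i) \<and> (\<forall>i. w (- i) = - w i) \<and> (\<forall>i. w (w i) = i)}"
proof -
  \<comment> \<open>An involution is automatically bijective, so of \<open>permutes\<close> only the
    fixing of the complement remains.\<close>
  have "\<exists>!x. w x = y" if "\<forall>i. w (w i) = i" for w :: "int \<Rightarrow> int" and y
    using that by metis
  then have "w permutes S \<longleftrightarrow> (\<forall>i. i \<notin> S \<longrightarrow> w i = i)" if "\<forall>i. w (w i) = i"
    for w :: "int \<Rightarrow> int" and S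
    unfolding permutes_def using that by blast
  then show ?thesis
    using in_pm_iff[OF assms] by (auto simp: signed_invs_def signed_def fun_eq_iff simp del: Un_iff)
qed

text \<open>k may be negative, and \<open>\<bar>k\<bar> = m\<close> is allowed: k = m fixes m and k
  = -m negates it, so one construction covers every image of m. With w = \<open>id\<close> it is the
  reflection in e_m - e_k, or in e_m when k = -m.\<close>

definition swap_in :: "int \<Rightarrow> int \<Rightarrow> (int \<Rightarrow> int) \<Rightarrow> int \<Rightarrow> int" where
  "swap_in m k w = (\<lambda>i. if i = m then k else if i = k then m
     else if i = - m then - k else if i = - k then - m else w i)"

lemma swap_in_signed_invs:
  assumes "w \<in> signed_invs (X - {m, \<bar>k\<bar>})" "m \<in> X" "\<bar>k\<bar> \<in> X" and X: "\<And>i. i \<in> X \<Longrightarrow> i > 0"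
  shows "swap_in m k w \<in> signed_invs X"
proof -
  have pos: "m > 0" "k \<noteq> 0" using X[OF assms(2)] X[OF assms(3)] by auto
  have w: "\<And>i. \<bar>i\<bar> \<notin> X - {m, \<bar>k\<bar>} \<Longrightarrow> w i = i"
    "\<And>i. w (- i) = - w i" "\<And>i. w (w i) = i"
    using assms(1) by (subst (asm) signed_invs_altdef; use X in auto)+
  have fixed: "w m = m" "w k = k" "w (- m) = - m" "w (- k) = - k"
    using pos by (auto intro!: w(1))
  have ne: "w i \<noteq> m" "w i \<noteq> k" "w i \<noteq> - m" "w i \<noteq> - k"
    if "i \<noteq> m" "i \<noteq> k" "i \<noteq> - m" "i \<noteq> - k" for i
    using that fixed w(3) by metis+
  have "swap_in m k w i = i" if "\<bar>i\<bar> \<notin> X" for i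
    using that assms(2,3) pos w(1)[of i] by (auto simp: swap_in_def)
  moreover have "swap_in m k w (- i) = - swap_in m k w i" for i
    using pos w(2) by (auto simp: swap_in_def)
  moreover have "swap_in m k w (swap_in m k w i) = i" for i
    using pos fixed ne w(3) by (auto simp: swap_in_def)
  ultimately show ?thesis by (simp add: signed_invs_altdef X)
qed

text \<open>An involution taking m to k takes k to m, and by oddness preserves the set of m, -m, k,
  -k. Resetting it to the identity there undoes \<open>swap_in\<close>.\<close>

lemma signed_invs_eq_image_swap_in:
  assumes "m \<in> X" "\<bar>k\<bar> \<in> X" and X: "\<And>i. i \<in> X \<Longrightarrow> i > 0"
  shows "{w \<in> signed_invs X. w m = k} = swap_in m k ` signed_invs (X - {m, \<bar>k\<bar>})"
proof (intro equalityI subsetI)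
  fix w assume "w \<in> {w \<in> signed_invs X. w m = k}"
  then have w: "\<And>i. \<bar>i\<bar> \<notin> X \<Longrightarrow> w i = i"
    "\<And>i. w (- i) = - w i" "\<And>i. w (w i) = i" "w m = k"
    by (auto simp: signed_invs_altdef[OF X])
  define y where "y i = (if i \<in> {m, -m, k, -k} then i else w i)" for i
  have wk: "w k = m" "w (- m) = - k" "w (- k) = - m" using w by metis+
  have ne: "w i \<notin> {m, -m, k, -k}" if "i \<notin> {m, -m, k, -k}" for i
    using that w(3,4) wk by (metis insert_iff singletonD)
  have "y i = i" if "\<bar>i\<bar> \<notin> X - {m, \<bar>k\<bar>}" for i
    using that w(1)[of i] by (auto simp: y_def abs_if split: if_splits)
  moreover have "y (- i) = - y i" for i
    using w(2) by (auto simp: y_def)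
  moreover have "y (y i) = i" for i
    using ne w(3) by (auto simp: y_def)
  ultimately have "y \<in> signed_invs (X - {m, \<bar>k\<bar>})"
    by (subst signed_invs_altdef) (auto simp: X)
  moreover have "w = swap_in m k y"
    using w(4) wk by (auto simp: swap_in_def y_def)
  ultimately show "w \<in> swap_in m k ` signed_invs (X - {m, \<bar>k\<bar>})" by blast
next
  fix w assume "w \<in> swap_in m k ` signed_invs (X - {m, \<bar>k\<bar>})"
  then show "w \<in> {w \<in> signed_invs X. w m = k}"
    using swap_in_signed_invs assms by (auto simp: swap_in_def)
qed

lemma inj_on_swap_in:
  assumes "m \<in> X" and X: "\<And>i. i \<in> X \<Longrightarrow> i > 0"
  shows "inj_on (swap_in m k) (signed_invs (X - {m, \<bar>k\<bar>}))"
proof (rule inj_onI, rule ext)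
  fix w v i assume *: "w \<in> signed_invs (X - {m, \<bar>k\<bar>})" "v \<in> signed_invs (X - {m, \<bar>k\<bar>})"
    "swap_in m k w = swap_in m k v"
  have fixed: "w i = i \<and> v i = i" if "\<bar>i\<bar> \<notin> X - {m, \<bar>k\<bar>}"
    using * that by (subst (asm) (1 2) signed_invs_altdef) (auto simp: X)
  show "w i = v i"
  proof (cases "i \<in> {m, -m, k, -k}")
    case True
    then have "\<bar>i\<bar> \<notin> X - {m, \<bar>k\<bar>}" using X[OF assms(1)] by auto
    then show ?thesis using fixed by simp
  next
    case False
    then show ?thesis using fun_cong[OF *(3), of i] by (simp add: swap_in_def)
  qed
qed


section \<open>Recursion for sums over signed involutions\<close>

text \<open>Every remaining index a is compared with \<open>\<bar>k\<bar>\<close>, whose value has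
  absolute value m, and with m, whose value is k. The first comparison depends on the position of a
  relative to \<open>\<bar>k\<bar>\<close>, the second in the same way on
  \<open>\<bar>y a\<bar>\<close>. As \<open>\<bar>y a\<bar>\<close> runs through the same set as a,
  both totals agree, whence the factor 2.\<close>

lemma D_len_swap_in:
  assumes "finite Z" and Z: "\<And>i. i \<in> Z \<Longrightarrow> 0 < i \<and> i < m" and k: "\<bar>k\<bar> \<in> Z"
    and y: "y \<in> signed_invs (Z - {\<bar>k\<bar>})"
  shows "D_len (insert m Z) (swap_in m k y) = D_len (Z - {\<bar>k\<bar>}) y + 1 +
      2 * (card {i \<in> Z. \<bar>k\<bar> < i} + (if k < 0 then 2 * card {i \<in> Z. i < \<bar>k\<bar>} else 0))"
    and "negs (insert m Z) (swap_in m k y) = negs (Z - {\<bar>k\<bar>}) y + (if k < 0 then 2 else 0)"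
proof -
  define Z' where "Z' = Z - {\<bar>k\<bar>}"
  define w where "w = swap_in m k y"
  have ins: "insert m Z = insert m (insert \<bar>k\<bar> Z')" and fin: "finite Z'" and kn: "\<bar>k\<bar> \<notin> Z'"
    using k assms(1) by (auto simp: Z'_def)
  have mn: "m \<notin> insert \<bar>k\<bar> Z'" using Z k by (auto simp: Z'_def)
  have Z'm: "0 < a \<and> a < m \<and> a \<noteq> \<bar>k\<bar>" if "a \<in> Z'" for a using Z that by (auto simp: Z'_def)
  have km: "k \<noteq> 0" "\<bar>k\<bar> < m" using Z[OF k] by auto
  have y': "y \<in> signed Z'" using y by (simp add: Z'_def signed_invs_def)
  have yabs: "\<bar>y a\<bar> \<in> Z'" if "a \<in> Z'" for a
    using signed_abs_in[OF y'] that Z'm by blast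
  have w: "w m = k" "w \<bar>k\<bar> = sgn k * m" "\<And>a. a \<in> Z' \<Longrightarrow> w a = y a"
    using km by (auto simp: w_def swap_in_def abs_if sgn_if dest: Z'm)
  define c where "c = (if k < 0 then 2 else 0 :: nat)"
  \<comment> \<open>The contribution common to both comparisons: below \<open>\<bar>k\<bar>\<close>
    both roots or none turn negative, according to the sign of k; above it exactly one does.\<close>
  define r where "r a = (if a < \<bar>k\<bar> then c else 1)" for a
  have "D_len (insert m Z) w = D_len Z' w
      + (\<Sum>a\<in>Z'. if a < \<bar>k\<bar> then D_neg (w a) (w \<bar>k\<bar>) else D_neg (w \<bar>k\<bar>) (w a))
      + (D_neg (w \<bar>k\<bar>) (w m) + (\<Sum>a\<in>Z'. D_neg (w a) (w m)))"
    unfolding ins using fin kn mn km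
    by (simp add: D_len_insert) (intro sum.cong, auto dest: Z'm)
  also have "D_len Z' w = D_len Z' y" using w by (intro D_len_cong) auto
  also have "(\<Sum>a\<in>Z'. if a < \<bar>k\<bar> then D_neg (w a) (w \<bar>k\<bar>) else D_neg (w \<bar>k\<bar>) (w a)) = sum r Z'"
  proof (rule sum.cong)
    fix a assume a: "a \<in> Z'"
    show "(if a < \<bar>k\<bar> then D_neg (w a) (w \<bar>k\<bar>) else D_neg (w \<bar>k\<bar>) (w a)) = r a"
      using a w km Z'm[OF yabs[OF a]] by (auto simp: D_neg_def r_def c_def sgn_if abs_mult)
  qed simp
  \<comment> \<open>The larger absolute value m stands at the smaller index, so exactly one of the
    two roots turns negative.\<close>
  also have "D_neg (w \<bar>k\<bar>) (w m) = 1"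
    using w km by (auto simp: D_neg_def sgn_if)
  also have "(\<Sum>a\<in>Z'. D_neg (w a) (w m)) = (\<Sum>a\<in>Z'. r \<bar>y a\<bar>)"
    using w by (intro sum.cong) (auto simp: D_neg_def r_def c_def)
  also have "\<dots> = sum r Z'"
    using signed_abs_bij[OF y' fin] Z'm by (intro sum.reindex_bij_betw) auto
  also have "sum r Z' = c * card {a \<in> Z. a < \<bar>k\<bar>} + card {a \<in> Z. \<bar>k\<bar> < a}"
  proof -
    have "Z' \<inter> {a. a < \<bar>k\<bar>} = {a \<in> Z. a < \<bar>k\<bar>}" "Z' \<inter> - {a. a < \<bar>k\<bar>} = {a \<in> Z. \<bar>k\<bar> < a}"
      by (auto simp: Z'_def)
    then show ?thesis using fin by (simp add: r_def sum.If_cases)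
  qed
  finally show "D_len (insert m Z) (swap_in m k y) = D_len (Z - {\<bar>k\<bar>}) y + 1 +
      2 * (card {i \<in> Z. \<bar>k\<bar> < i} + (if k < 0 then 2 * card {i \<in> Z. i < \<bar>k\<bar>} else 0))"
    by (simp add: w_def Z'_def c_def)
  have "negs (insert m Z) w = negs Z' w + c"
    unfolding ins using fin kn mn km w by (auto simp: negs_insert sgn_if c_def)
  also have "negs Z' w = negs Z' y" using w by (intro negs_cong) auto
  finally show "negs (insert m Z) (swap_in m k y) = negs (Z - {\<bar>k\<bar>}) y + (if k < 0 then 2 else 0)"
    by (simp add: w_def Z'_def c_def)
qed

text \<open>The value at the last index m dominates all others in absolute value, so its sign alone
  decides both roots attached to each other index.\<close>

lemma D_len_swap_in_self:
  assumes "finite Z" and Z: "\<And>i. i \<in> Z \<Longrightarrow> 0 < i \<and> i < m" and "0 < m" "\<bar>k\<bar> = m"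
    and y: "y \<in> signed_invs Z"
  shows "D_len (insert m Z) (swap_in m k y) = D_len Z y + (if k < 0 then 2 * card Z else 0)"
    and "negs (insert m Z) (swap_in m k y) = negs Z y + (if k < 0 then 1 else 0)"
proof -
  define w where "w = swap_in m k y"
  have mn: "m \<notin> Z" using Z by auto
  have y': "y \<in> signed Z" using y by (simp add: signed_invs_def)
  have "a \<notin> {m, - m, k, - k}" if "a \<in> Z" for a
    using assms(3,4) Z[OF that] by auto
  then have w: "w m = k" "\<And>a. a \<in> Z \<Longrightarrow> w a = y a"
    by (auto simp: w_def swap_in_def)
  have "D_len (insert m Z) w = D_len Z w + (\<Sum>a\<in>Z. D_neg (w a) (w m))"
    using assms(1) mn by (simp add: D_len_insert) (intro sum.cong, auto dest: Z)
  also have "D_len Z w = D_len Z y" using w by (intro D_len_cong) auto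
  also have "(\<Sum>a\<in>Z. D_neg (w a) (w m)) = (\<Sum>a\<in>Z. if k < 0 then 2 else 0)"
  proof (rule sum.cong)
    fix a assume a: "a \<in> Z"
    have "\<bar>y a\<bar> < m" using signed_abs_in[OF y'] a Z by blast
    then show "D_neg (w a) (w m) = (if k < 0 then 2 else 0)"
      unfolding D_neg_def w(1) w(2)[OF a] assms(4) by simp
  qed simp
  finally show "D_len (insert m Z) (swap_in m k y) = D_len Z y + (if k < 0 then 2 * card Z else 0)"
    by (simp add: w_def)
  have "negs (insert m Z) w = negs Z w + (if k < 0 then 1 else 0)"
    using assms(1) mn w by (simp add: negs_insert)
  also have "negs Z w = negs Z y" using w by (intro negs_cong) auto
  finally show "negs (insert m Z) (swap_in m k y) = negs Z y + (if k < 0 then 1 else 0)"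
    by (simp add: w_def)
qed

definition inv_sum :: "(nat \<Rightarrow> nat \<Rightarrow> 'a::comm_monoid_add) \<Rightarrow> int set \<Rightarrow> 'a" where
  "inv_sum f X = (\<Sum>w\<in>signed_invs X. f (D_len X w) (negs X w))"

text \<open>Recording the change of the statistics in the weight, not in the summand, lets the
  induction hypothesis be applied to the shifted weight.\<close>

definition shift :: "nat \<Rightarrow> nat \<Rightarrow> (nat \<Rightarrow> nat \<Rightarrow> 'a) \<Rightarrow> nat \<Rightarrow> nat \<Rightarrow> 'a" where
  "shift c d f a b = f (a + c) (b + d)"

lemma inv_sum_empty: "inv_sum f {} = f 0 0"
proof -
  have "signed_invs {} = {id}"
    by (subst signed_invs_altdef) auto
  then show ?thesis by (simp add: inv_sum_def)
qed

lemma inv_sum_insert: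
  assumes "finite Z" and Z: "\<And>i. i \<in> Z \<Longrightarrow> 0 < i \<and> i < m" and "0 < m"
  shows "inv_sum f (insert m Z) = inv_sum f Z + inv_sum (shift (2 * card Z) 1 f) Z +
    (\<Sum>k\<in>Z. inv_sum (shift (1 + 2 * card {i \<in> Z. k < i}) 0 f) (Z - {k}) +
      inv_sum (shift (1 + 2 * card {i \<in> Z. k < i} + 4 * card {i \<in> Z. i < k}) 2 f) (Z - {k}))"
proof -
  let ?X = "insert m Z"
  define F where "F w = f (D_len ?X w) (negs ?X w)" for w
  define T where "T k = (\<Sum>w | w \<in> signed_invs ?X \<and> w m = k. F w)" for k
  have X: "\<And>i. i \<in> ?X \<Longrightarrow> i > 0" and fin: "finite ?X" using Z assms by auto
  \<comment> \<open>For k = m or k = -m the set removed is just {m}, so the two exceptional images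
    are handled together with the others.\<close>
  have T: "T k = (\<Sum>y\<in>signed_invs (?X - {m, \<bar>k\<bar>}). F (swap_in m k y))" if "\<bar>k\<bar> \<in> ?X" for k
  proof -
    have "{w \<in> signed_invs ?X. w m = k} = swap_in m k ` signed_invs (?X - {m, \<bar>k\<bar>})"
      by (rule signed_invs_eq_image_swap_in[OF _ that X]) simp_all
    moreover have "inj_on (swap_in m k) (signed_invs (?X - {m, \<bar>k\<bar>}))"
      by (rule inj_on_swap_in[OF _ X]) simp_all
    ultimately show ?thesis unfolding T_def by (simp only: sum.reindex comp_def)
  qed
  have "inv_sum f ?X = sum T (?X \<union> uminus ` ?X)"
    unfolding inv_sum_def F_def[symmetric] T_def
  proof (rule sum.group[symmetric])
    show "(\<lambda>w. w m) ` signed_invs ?X \<subseteq> ?X \<union> uminus ` ?X"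
      using permutes_in_image[OF signedD(1)] unfolding signed_invs_def by blast
  qed (use fin finite_signed_invs in auto)
  also have "\<dots> = sum T ?X + sum T (uminus ` ?X)"
  proof (rule sum.union_disjoint)
    have "- x \<notin> ?X" if "x \<in> ?X" for x
      using X[of x] X[of "- x"] that by linarith
    then show "?X \<inter> uminus ` ?X = {}" by blast
  qed (use fin in simp_all)
  also have "sum T (uminus ` ?X) = (\<Sum>k\<in>?X. T (- k))"
    by (subst sum.reindex) (simp_all add: inj_on_def)
  also have "sum T ?X + (\<Sum>k\<in>?X. T (- k)) = T m + T (- m) + (\<Sum>k\<in>Z. T k + T (- k))"
  proof -
    have "m \<notin> Z" using Z by auto
    then show ?thesis using assms(1) by (simp add: sum.distrib ac_simps)
  qed
  also have "T m = inv_sum f Z"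
  proof -
    have "?X - {m, \<bar>m\<bar>} = Z" using Z assms(3) by auto
    then show ?thesis
      using T[of m] D_len_swap_in_self[OF assms(1) Z assms(3), of m] assms(3)
      by (simp add: inv_sum_def F_def)
  qed
  also have "T (- m) = inv_sum (shift (2 * card Z) 1 f) Z"
  proof -
    have "?X - {m, \<bar>- m\<bar>} = Z" using Z assms(3) by auto
    then show ?thesis
      using T[of "- m"] D_len_swap_in_self[OF assms(1) Z assms(3), of "- m"] assms(3)
      by (simp add: inv_sum_def F_def shift_def)
  qed
  also have "(\<Sum>k\<in>Z. T k + T (- k)) =
    (\<Sum>k\<in>Z. inv_sum (shift (1 + 2 * card {i \<in> Z. k < i}) 0 f) (Z - {k}) +
      inv_sum (shift (1 + 2 * card {i \<in> Z. k < i} + 4 * card {i \<in> Z. i < k}) 2 f) (Z - {k}))"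
  proof (rule sum.cong)
    fix k assume k: "k \<in> Z"
    have pos: "\<bar>k\<bar> = k" "k > 0" and "m \<notin> Z" using Z[OF k] Z[of m] by auto
    then have eq: "?X - {m, \<bar>k\<bar>} = Z - {k}" "?X - {m, \<bar>- k\<bar>} = Z - {k}" by auto
    have "T k = inv_sum (shift (1 + 2 * card {i \<in> Z. k < i}) 0 f) (Z - {k})"
      using T[of k] D_len_swap_in[OF assms(1) Z, of k] k eq pos
      by (simp add: inv_sum_def F_def shift_def)
    moreover have "T (- k) = inv_sum
        (shift (1 + 2 * card {i \<in> Z. k < i} + 4 * card {i \<in> Z. i < k}) 2 f) (Z - {k})"
      using T[of "- k"] D_len_swap_in[OF assms(1) Z, of "- k"] k eq pos
      by (simp add: inv_sum_def F_def shift_def algebra_simps)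
    ultimately show "T k + T (- k) = inv_sum (shift (1 + 2 * card {i \<in> Z. k < i}) 0 f) (Z - {k}) +
      inv_sum (shift (1 + 2 * card {i \<in> Z. k < i} + 4 * card {i \<in> Z. i < k}) 2 f) (Z - {k})"
      by simp
  qed simp
  finally show ?thesis .
qed

text \<open>n is the number of elements besides the maximum, r the rank of
  \<open>\<bar>k\<bar>\<close> among them and \<open>n - Suc r\<close> the number of elements above
  it. For n = 0 the sum is empty, so the truncated \<open>n - 1\<close> does no harm.\<close>

fun inv_rec :: "(nat \<Rightarrow> nat \<Rightarrow> 'a::comm_monoid_add) \<Rightarrow> nat \<Rightarrow> 'a" where
  "inv_rec f 0 = f 0 0"
| "inv_rec f (Suc n) = inv_rec f n + inv_rec (shift (2 * n) 1 f) n +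
    (\<Sum>r<n. inv_rec (shift (1 + 2 * (n - Suc r)) 0 f) (n - 1) +
      inv_rec (shift (1 + 2 * (n - Suc r) + 4 * r) 2 f) (n - 1))"

text \<open>Each rank occurs exactly once: a new maximum leaves the old ranks alone and adds the
  next one.\<close>

lemma sum_ranks:
  fixes F :: "nat \<Rightarrow> 'a::comm_monoid_add" and Z :: "'b::linorder set"
  assumes "finite Z"
  shows "(\<Sum>k\<in>Z. F (card {i \<in> Z. i < k})) = (\<Sum>r<card Z. F r)"
  using assms
proof (induction Z rule: finite_linorder_max_induct)
  case (insert b A)
  have "{i \<in> insert b A. i < k} = {i \<in> A. i < k}" if "k \<in> A" for k
    using insert.hyps that by force
  moreover have "{i \<in> insert b A. i < b} = A" using insert.hyps by auto
  moreover have "b \<notin> A" using insert.hyps by auto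
  ultimately show ?case using insert by (simp add: add.commute)
qed simp

lemma card_greater_eq:
  fixes Z :: "'b::linorder set"
  assumes "finite Z" "k \<in> Z"
  shows "card {i \<in> Z. k < i} = card Z - Suc (card {i \<in> Z. i < k})"
proof -
  have "Z = {i \<in> Z. k < i} \<union> insert k {i \<in> Z. i < k}" using assms by auto
  then have "card Z = card {i \<in> Z. k < i} + card (insert k {i \<in> Z. i < k})"
    using assms by (subst card_Un_disjoint[symmetric]) auto
  then show ?thesis using assms by simp
qed

text \<open>The shifts in \<open>inv_sum_insert\<close> see the removed element only through its
  rank, so the sum over elements becomes a sum over ranks and the actual elements disappear.\<close>

lemma inv_sum_eq_inv_rec:
  fixes f :: "nat \<Rightarrow> nat \<Rightarrow> 'a::comm_monoid_add"
  assumes "finite X" "\<And>i. i \<in> X \<Longrightarrow> i > 0"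
  shows "inv_sum f X = inv_rec f (card X)"
  using assms
proof (induction "card X" arbitrary: X f rule: less_induct)
  case less
  show ?case
  proof (cases "X = {}")
    case True
    then show ?thesis by (simp add: inv_sum_empty)
  next
    case False
    define m Z where "m = Max X" and "Z = X - {m}"
    have X: "X = insert m Z" "m \<notin> Z" "finite Z" "0 < m"
      using Max_in[OF less.prems(1) False] less.prems by (auto simp: m_def Z_def)
    have Z: "0 < i \<and> i < m" if "i \<in> Z" for i
      using that less.prems Max_ge[of X i] by (auto simp: m_def Z_def order_less_le)
    have IH: "inv_sum g Z = inv_rec g (card Z)" for g :: "nat \<Rightarrow> nat \<Rightarrow> 'a"
      using less.hyps[of Z g] X Z by auto
    have IH': "inv_sum g (Z - {k}) = inv_rec g (card Z - 1)" if "k \<in> Z" for g :: "nat \<Rightarrow> nat \<Rightarrow> 'a" and k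
    proof -
      have "card (Z - {k}) = card Z - 1" using that X by simp
      moreover have "card (Z - {k}) < card X" using that X by (simp add: less_Suc_eq_le)
      ultimately show ?thesis using less.hyps[of "Z - {k}" g] Z X by auto
    qed
    define n where "n = card Z"
    define F where "F r = inv_rec (shift (1 + 2 * (n - Suc r)) 0 f) (n - 1) +
      inv_rec (shift (1 + 2 * (n - Suc r) + 4 * r) 2 f) (n - 1)" for r
    have "inv_sum f X = inv_sum f Z + inv_sum (shift (2 * card Z) 1 f) Z +
      (\<Sum>k\<in>Z. inv_sum (shift (1 + 2 * card {i \<in> Z. k < i}) 0 f) (Z - {k}) +
        inv_sum (shift (1 + 2 * card {i \<in> Z. k < i} + 4 * card {i \<in> Z. i < k}) 2 f) (Z - {k}))"
      unfolding X(1) by (rule inv_sum_insert[OF X(3) Z X(4)])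
    also have "\<dots> = inv_rec f n + inv_rec (shift (2 * n) 1 f) n
        + (\<Sum>k\<in>Z. F (card {i \<in> Z. i < k}))"
      unfolding IH F_def n_def
      by (intro arg_cong2[of _ _ _ _ "(+)"] sum.cong refl) (simp_all add: IH' card_greater_eq X(3))
    also have "\<dots> = inv_rec f (Suc n)"
      using X(3) by (simp add: sum_ranks n_def[symmetric]) (simp add: F_def)
    finally show ?thesis using X by (simp add: n_def)
  qed
qed


section \<open>Multiplication by simple reflections\<close>

text \<open>With p, q the values at i and i + 1, these are the effects on that one pair of the
  reflections in e_(i+1) - e_i and, for i = 1, in e_1 + e_2. The conditions q < p and p + q < 0 say
  that the respective simple root is sent to a negative root.\<close>

lemma D_neg_commute:
  assumes "\<bar>p\<bar> \<noteq> \<bar>q\<bar>"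
  shows "D_neg q p \<le> Suc (D_neg p q)" "q < p \<Longrightarrow> D_neg q p < D_neg p q"
    "D_neg (- q) (- p) \<le> Suc (D_neg p q)" "p + q < 0 \<Longrightarrow> D_neg (- q) (- p) < D_neg p q"
  using assms by (auto simp: D_neg_def)

lemma D_neg_abs_left: "D_neg p q = D_neg p' q" if "\<bar>p\<bar> = \<bar>p'\<bar>"
  using that by (simp add: D_neg_def)

lemma atLeastAtMost_pos: "i \<in> {1..int n} \<Longrightarrow> 0 < i"
  by simp

lemma signed_interval_abs:
  assumes "x \<in> signed {1..int n}" "1 \<le> \<bar>i\<bar>" "\<bar>i\<bar> \<le> int n"
  shows "1 \<le> \<bar>x i\<bar>" "\<bar>x i\<bar> \<le> int n"
proof -
  have "i \<in> {1..int n} \<union> uminus ` {1..int n}"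
    using assms(2,3) by (subst in_pm_iff) auto
  from signed_abs_in[OF assms(1) this] show "1 \<le> \<bar>x i\<bar>" "\<bar>x i\<bar> \<le> int n" by auto
qed

lemma swap_in_id: "1 \<le> m \<Longrightarrow> m \<le> int n \<Longrightarrow> 1 \<le> \<bar>k\<bar> \<Longrightarrow> \<bar>k\<bar> \<le> int n \<Longrightarrow>
  swap_in m k id \<in> signed_invs {1..int n}"
  by (rule swap_in_signed_invs) (auto simp: signed_invs_def signed_def permutes_id)

text \<open>The sign \<open>c = - 1\<close>, with \<open>i = 1\<close>, gives the reflection in \<open>e\<^sub>1 + e\<^sub>2\<close>.\<close>

lemma D_len_comp_swap_in:
  assumes x: "x \<in> signed {1..int n}" and i: "1 \<le> i" "i < int n" and c: "c = 1 \<or> c = - 1 \<and> i = 1"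
  shows "D_len {1..int n} (x \<circ> swap_in (i + 1) (c * i) id) + D_neg (x i) (x (i + 1)) =
      D_len {1..int n} x + D_neg (x (c * (i + 1))) (x (c * i))"
proof -
  define Z where "Z = {1..int n} - {i, i + 1}"
  define x' where "x' = x \<circ> swap_in (i + 1) (c * i) id"
  have ins: "{1..int n} = insert i (insert (i + 1) Z)" and Z: "finite Z" "i \<notin> insert (i + 1) Z" "i + 1 \<notin> Z"
    using i by (auto simp: Z_def)
  \<comment> \<open>No index lies strictly between i and i + 1, so each other a is on the same side
    of both and its two terms can be grouped.\<close>
  have D: "D_len {1..int n} y = D_len Z y + D_neg (y i) (y (i + 1)) +
      (\<Sum>a\<in>Z. if a < i then D_neg (y a) (y i) + D_neg (y a) (y (i + 1))
        else D_neg (y i) (y a) + D_neg (y (i + 1)) (y a))" for y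
  proof -
    have "(\<Sum>a\<in>Z. if a < i + 1 then D_neg (y a) (y (i + 1)) else D_neg (y (i + 1)) (y a)) =
      (\<Sum>a\<in>Z. if a < i then D_neg (y a) (y (i + 1)) else D_neg (y (i + 1)) (y a))"
      using Z by (intro sum.cong) (auto simp: order_le_less)
    moreover have "(\<Sum>a\<in>Z. if a < i then D_neg (y a) (y i) else D_neg (y i) (y a)) +
      (\<Sum>a\<in>Z. if a < i then D_neg (y a) (y (i + 1)) else D_neg (y (i + 1)) (y a)) =
      (\<Sum>a\<in>Z. if a < i then D_neg (y a) (y i) + D_neg (y a) (y (i + 1))
        else D_neg (y i) (y a) + D_neg (y (i + 1)) (y a))"
      unfolding sum.distrib[symmetric] by (intro sum.cong) auto
    ultimately show ?thesis
      unfolding ins using Z by (simp add: D_len_insert)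
  qed
  have x': "x' i = x (c * (i + 1))" "x' (i + 1) = x (c * i)" "\<And>a. a \<in> Z \<Longrightarrow> x' a = x a"
    using i c by (auto simp: x'_def swap_in_def Z_def)
  have abs: "\<bar>x' i\<bar> = \<bar>x (i + 1)\<bar>" "\<bar>x' (i + 1)\<bar> = \<bar>x i\<bar>"
    using c unfolding x' signed_abs_eq_iff[OF x] by auto
  have "D_len Z x' = D_len Z x" using x' by (intro D_len_cong) auto
  moreover have "(\<Sum>a\<in>Z. if a < i then D_neg (x' a) (x' i) + D_neg (x' a) (x' (i + 1))
        else D_neg (x' i) (x' a) + D_neg (x' (i + 1)) (x' a)) =
      (\<Sum>a\<in>Z. if a < i then D_neg (x a) (x i) + D_neg (x a) (x (i + 1))
        else D_neg (x i) (x a) + D_neg (x (i + 1)) (x a))"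
  proof (rule sum.cong)
    fix a assume a: "a \<in> Z"
    \<comment> \<open>A sign change is visible to \<open>D_neg\<close> only in its second argument,
      that is, for some a below i. For c = -1 there is none, as i = 1.\<close>
    have "c = 1" if "a < i" using that a c i by (auto simp: Z_def)
    then show "(if a < i then D_neg (x' a) (x' i) + D_neg (x' a) (x' (i + 1))
        else D_neg (x' i) (x' a) + D_neg (x' (i + 1)) (x' a)) =
      (if a < i then D_neg (x a) (x i) + D_neg (x a) (x (i + 1))
        else D_neg (x i) (x a) + D_neg (x (i + 1)) (x a))"
      using D_neg_abs_left[OF abs(1), of "x a"] D_neg_abs_left[OF abs(2), of "x a"]
      unfolding x'(3)[OF a] by (auto simp: x')
  qed simp
  ultimately show ?thesis
    using D[of x] D[of x'] unfolding x'(1,2) x'_def[symmetric] by simp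
qed

lemma negs_comp_swap_in:
  assumes "1 \<le> i" "i < int n"
  shows "negs {1..int n} (x \<circ> swap_in (i + 1) i id) = negs {1..int n} x"
proof -
  define Z where "Z = {1..int n} - {i, i + 1}"
  define x' where "x' = x \<circ> swap_in (i + 1) i id"
  have ins: "{1..int n} = insert i (insert (i + 1) Z)" and Z: "finite Z" "i \<notin> insert (i + 1) Z" "i + 1 \<notin> Z"
    using assms by (auto simp: Z_def)
  have x': "x' i = x (i + 1)" "x' (i + 1) = x i" "\<And>a. a \<in> Z \<Longrightarrow> x' a = x a"
    using assms by (auto simp: x'_def swap_in_def Z_def)
  have "negs Z x' = negs Z x" using x' by (intro negs_cong) auto
  then show ?thesis
    unfolding ins x'_def[symmetric] using Z x' by (simp add: negs_insert)
qed

text \<open>Exchanging and negating two nonzero values turns j negative ones among them into 2 -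
  j.\<close>

lemma even_negs_comp_swap_in:
  assumes x: "x \<in> signed {1..int n}" and "2 \<le> n"
  shows "even (negs {1..int n} (x \<circ> swap_in 2 (- 1) id)) \<longleftrightarrow> even (negs {1..int n} x)"
proof -
  define Z where "Z = {3..int n}"
  define x' where "x' = x \<circ> swap_in 2 (- 1) id"
  have ins: "{1..int n} = insert 1 (insert 2 Z)" and Z: "finite Z" "1 \<notin> insert 2 Z" "2 \<notin> Z"
    using assms by (auto simp: Z_def)
  have x': "x' 1 = - x 2" "x' 2 = - x 1" "\<And>a. a \<in> Z \<Longrightarrow> x' a = x a"
    using signedD(2)[OF x, of 1] signedD(2)[OF x, of 2]
    by (auto simp: x'_def swap_in_def Z_def)
  have "negs Z x' = negs Z x" using x' by (intro negs_cong) auto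
  moreover have "x 1 \<noteq> 0" "x 2 \<noteq> 0" using signed_eq_0_iff[OF x] by auto
  ultimately show ?thesis
    unfolding ins x'_def[symmetric] using Z x' by (auto simp: negs_insert)
qed

text \<open>The smallest index 1 enters \<open>D_neg\<close> only as first argument, where signs are
  ignored; negating its value therefore affects \<open>negs\<close> alone.\<close>

lemma comp_swap_in_neg:
  assumes x: "x \<in> signed {1..int n}" and "1 \<le> n"
  shows "D_len {1..int n} (x \<circ> swap_in 1 (- 1) id) = D_len {1..int n} x"
    and "x 1 < 0 \<Longrightarrow> negs {1..int n} (x \<circ> swap_in 1 (- 1) id) < negs {1..int n} x"
    and "negs {1..int n} (x \<circ> swap_in 1 (- 1) id) \<le> Suc (negs {1..int n} x)"
proof -
  define Z where "Z = {2..int n}"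
  define x' where "x' = x \<circ> swap_in 1 (- 1) id"
  have ins: "{1..int n} = insert 1 Z" and Z: "finite Z" "1 \<notin> Z"
    using assms by (auto simp: Z_def)
  have x': "x' 1 = - x 1" "\<And>a. a \<in> Z \<Longrightarrow> x' a = x a"
    using signedD(2)[OF x, of 1] by (auto simp: x'_def swap_in_def Z_def)
  have "negs Z x' = negs Z x" using x' by (intro negs_cong) auto
  moreover have "x 1 \<noteq> 0" using signed_eq_0_iff[OF x] by auto
  ultimately show "x 1 < 0 \<Longrightarrow> negs {1..int n} (x \<circ> swap_in 1 (- 1) id) < negs {1..int n} x"
    and "negs {1..int n} (x \<circ> swap_in 1 (- 1) id) \<le> Suc (negs {1..int n} x)"
    unfolding ins x'_def[symmetric] using Z x' by (auto simp: negs_insert)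
  have "D_len Z x' = D_len Z x" using x' by (intro D_len_cong) auto
  moreover have "(\<Sum>a\<in>Z. if a < 1 then D_neg (x' a) (x' 1) else D_neg (x' 1) (x' a)) =
     (\<Sum>a\<in>Z. if a < 1 then D_neg (x a) (x 1) else D_neg (x 1) (x a))"
  proof (rule sum.cong)
    fix a assume a: "a \<in> Z"
    then show "(if a < 1 then D_neg (x' a) (x' 1) else D_neg (x' 1) (x' a)) =
      (if a < 1 then D_neg (x a) (x 1) else D_neg (x 1) (x a))"
      using D_neg_abs_left[of "x' 1" "x 1" "x a"] x' by (auto simp: Z_def)
  qed simp
  ultimately show "D_len {1..int n} (x \<circ> swap_in 1 (- 1) id) = D_len {1..int n} x"
    unfolding ins x'_def[symmetric] using Z by (simp add: D_len_insert)
qed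

lemma strict_mono_step_imp_le:
  fixes x :: "int \<Rightarrow> int"
  assumes "\<And>i. 1 \<le> i \<Longrightarrow> i < int n \<Longrightarrow> x i < x (i + 1)" "1 \<le> i" "i \<le> j" "j \<le> int n"
  shows "x i + (j - i) \<le> x j"
  using assms(3,4)
proof (induction j rule: int_ge_induct)
  case (step j)
  then show ?case using assms(1)[of j] assms(2) by simp
qed simp

text \<open>Without a descent \<open>\<bar>x 1\<bar> < x 2 < \<dots> < x n\<close>, which forces \<open>x i = i\<close> up to the sign of \<open>x 1\<close>.
  For \<open>n = 1\<close> the value \<open>x 2\<close> is \<open>2\<close>, so the second alternative of \<open>pos\<close> also covers type \<open>D\<^sub>1\<close>.\<close>

lemma signed_no_descent:
  assumes x: "x \<in> signed {1..int n}"
    and mono: "\<And>i. 1 \<le> i \<Longrightarrow> i < int n \<Longrightarrow> x i < x (i + 1)"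
    and pos: "x 1 > 0 \<or> x 1 + x 2 > 0 \<and> even (negs {1..int n} x)"
  shows "x = id"
proof -
  have bd: "1 \<le> \<bar>x i\<bar>" "\<bar>x i\<bar> \<le> int n" if "1 \<le> i" "i \<le> int n" for i
    using signed_interval_abs[OF x, of i] that by auto
  have fix2: "x i = i" if "2 \<le> i" "i \<le> int n" for i
  proof -
    have "x 1 < x 2" using mono[of 1] that by simp
    \<comment> \<open>Under either alternative of \<open>pos\<close>, x 2 = 1 would leave only x 1 =
      0 as a possible smaller value, but \<open>\<bar>x 1\<bar>\<close> is at least 1.\<close>
    then have "x 2 \<noteq> 1"
      using pos bd[of 1] that by auto
    moreover have "x 2 > 0" using pos \<open>x 1 < x 2\<close> by auto
    ultimately have "2 \<le> x 2" by simp
    \<comment> \<open>Consecutive values differ by at least 1, so x i is squeezed between the bound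
      coming from x 2 and the bound coming from x n.\<close>
    then have "i \<le> x i" using strict_mono_step_imp_le[of n x 2 i, OF mono] that by simp
    moreover have "x i \<le> i"
      using strict_mono_step_imp_le[of n x i "int n", OF mono] that bd[of "int n"] by simp
    ultimately show ?thesis by simp
  qed
  have fix1: "x 1 = 1" if "1 \<le> n"
  proof -
    have "\<bar>x 1\<bar> \<noteq> i" if "2 \<le> i" "i \<le> int n" for i
      using signed_abs_eq_iff[OF x, of 1 i] fix2[OF that] that by simp
    from this[of "\<bar>x 1\<bar>"] have "\<bar>x 1\<bar> = 1" using bd[of 1] that by linarith
    \<comment> \<open>The remaining candidate x 1 = -1 would have exactly one negative value,
      contradicting the even parity.\<close>
    moreover have "x 1 > 0"
    proof (rule ccontr)
      assume "\<not> x 1 > 0"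
      then have "x 1 < 0" "even (negs {1..int n} x)" using pos \<open>\<bar>x 1\<bar> = 1\<close> by auto
      moreover have "{i \<in> {1..int n}. x i < 0} = {1}"
      proof -
        have "i = 1" if "1 \<le> i" "i \<le> int n" "x i < 0" for i
          using fix2[of i] that by (cases "i = 1") auto
        then show ?thesis using \<open>x 1 < 0\<close> \<open>1 \<le> n\<close> by auto
      qed
      ultimately show False by (simp add: negs_def)
    qed
    ultimately show ?thesis by simp
  qed
  have fixpos: "x i = i" if "1 \<le> i" "i \<le> int n" for i
    using fix1 fix2[of i] that by (cases "i = 1") auto
  show ?thesis
  proof (rule ext)
    fix i
    consider "\<bar>i\<bar> \<notin> {1..int n}" | "1 \<le> i" "i \<le> int n" | "1 \<le> - i" "- i \<le> int n" by fastforce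
    then show "x i = id i"
    proof cases
      case 1
      then show ?thesis
        using permutes_not_in[OF signedD(1)[OF x], of i] by (subst (asm) in_pm_iff) auto
    next
      case 3
      then show ?thesis using fixpos[of "- i"] signedD(2)[OF x, of i] by simp
    qed (simp add: fixpos)
  qed
qed


section \<open>The groups of types B and D and their reflections\<close>

lemma id_signed: "id \<in> signed X"
  by (simp add: signed_def permutes_id)

lemma comp_signed: "v \<in> signed X \<Longrightarrow> w \<in> signed X \<Longrightarrow> v \<circ> w \<in> signed X"
  by (auto simp: signed_def intro: permutes_compose)

lemma carrier_W_B: "carrier (W_B n) = signed {1..int n}"
proof -
  have "{- int n..int n} - {0} = {1..int n} \<union> uminus ` {1..int n}"
  proof (rule Set.set_eqI)
    show "i \<in> {- int n..int n} - {0} \<longleftrightarrow> i \<in> {1..int n} \<union> uminus ` {1..int n}" for i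
      unfolding in_pm_iff[OF atLeastAtMost_pos] by auto
  qed
  then show ?thesis by (simp add: W_B_def signed_def)
qed

lemma carrier_W_D: "carrier (W_D n) = {w \<in> signed {1..int n}. even (negs {1..int n} w)}"
  by (simp add: W_D_def carrier_W_B negs_def)

lemma W_simps [simp]:
  "monoid.mult (W_B n) = (\<circ>)" "one (W_B n) = id"
  "monoid.mult (W_D n) = (\<circ>)" "one (W_D n) = id"
  by (simp_all add: W_D_def W_B_def)

lemma monoid_W_B: "monoid (W_B n)"
  by unfold_locales (auto simp: carrier_W_B id_signed comp_signed)

text \<open>The sign of \<open>v (w i)\<close> is the product of the signs of \<open>w i\<close> and
  \<open>v \<bar>w i\<bar>\<close>, and \<open>\<bar>w i\<bar>\<close> runs through X once.\<close>

lemma even_negs_comp: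
  assumes "v \<in> signed {1..int n}" "w \<in> signed {1..int n}"
  defines "X \<equiv> {1..int n}"
  shows "even (negs X (v \<circ> w)) \<longleftrightarrow> (even (negs X v) \<longleftrightarrow> even (negs X w))"
proof -
  have negs: "negs X v = (\<Sum>i\<in>X. of_bool (v i < 0))" for v
    by (simp add: negs_def Int_def X_def)
  have "(\<Sum>i\<in>X. of_bool (v i < 0) :: nat) = (\<Sum>i\<in>X. of_bool (v \<bar>w i\<bar> < 0))"
    using signed_abs_bij[OF assms(2)] by (intro sum.reindex_bij_betw[symmetric]) (simp add: X_def)
  then have "negs X v + negs X w = (\<Sum>i\<in>X. of_bool (v \<bar>w i\<bar> < 0) + of_bool (w i < 0))"
    by (simp add: negs sum.distrib)
  \<comment> \<open>The sum of two truth values is their exclusive or plus twice their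
    conjunction.\<close>
  also have "\<dots> = (\<Sum>i\<in>X. of_bool ((v \<circ> w) i < 0) + 2 * of_bool (w i < 0 \<and> v \<bar>w i\<bar> < 0))"
  proof (rule sum.cong)
    fix i assume "i \<in> X"
    then have "w i \<noteq> 0" "v (w i) \<noteq> 0"
      by (simp_all add: signed_eq_0_iff[OF assms(1)] signed_eq_0_iff[OF assms(2)] X_def)
    then show "of_bool (v \<bar>w i\<bar> < 0) + of_bool (w i < 0) =
        of_bool ((v \<circ> w) i < 0) + 2 * (of_bool (w i < 0 \<and> v \<bar>w i\<bar> < 0) :: nat)"
      using signedD(2)[OF assms(1), of "w i"] by (auto simp: abs_if)
  qed simp
  also have "\<dots> = negs X (v \<circ> w) + 2 * (\<Sum>i\<in>X. of_bool (w i < 0 \<and> v \<bar>w i\<bar> < 0))"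
    by (simp only: negs sum.distrib sum_distrib_left)
  finally have "even (negs X v + negs X w) = even (negs X (v \<circ> w))" by simp
  then show ?thesis by auto
qed

lemma negs_id [simp]: "negs {1..int n} id = 0"
proof -
  have "{i \<in> {1..int n}. id i < 0} = {}" by auto
  then show ?thesis by (simp only: negs_def card.empty)
qed

lemma monoid_W_D: "monoid (W_D n)"
  by unfold_locales
    (auto simp: carrier_W_D id_signed comp_signed even_negs_comp)

section \<open>The action on vectors, and signed transpositions as reflections\<close>

lemma bvec_uminus: "bvec (- i) = - bvec i"
  by (auto simp: bvec_def fun_eq_iff sgn_minus)

lemma bvec_inject: "bvec i = bvec j \<longleftrightarrow> i = j"
proof
  assume "bvec i = bvec j"
  then have "bvec i (nat \<bar>i\<bar>) = bvec j (nat \<bar>i\<bar>)" "bvec i (nat \<bar>j\<bar>) = bvec j (nat \<bar>j\<bar>)"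
    by simp_all
  then show "i = j"
    by (auto simp: bvec_def sgn_if abs_if split: if_splits)
qed simp

lemma act_add: "act n w (u + v) = act n w u + act n w v"
  by (simp add: act_def fun_eq_iff distrib_right sum.distrib)

lemma act_diff: "act n w (u - v) = act n w u - act n w v"
  by (simp add: act_def fun_eq_iff left_diff_distrib sum_subtractf)

lemma sum_bvec:
  assumes "1 \<le> \<bar>i\<bar>" "\<bar>i\<bar> \<le> int n"
  shows "(\<Sum>j=1..n. bvec i j * f j) = of_int (sgn i) * f (nat \<bar>i\<bar>)"
proof -
  have "(\<Sum>j=1..n. bvec i j * f j) = (\<Sum>j=1..n. if j = nat \<bar>i\<bar> then of_int (sgn i) * f j else 0)"
    by (intro sum.cong) (auto simp: bvec_def)
  then show ?thesis using assms by (simp add: le_nat_iff nat_le_iff)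
qed

lemma act_bvec:
  assumes w: "w \<in> signed {1..int n}" and "1 \<le> \<bar>i\<bar>" "\<bar>i\<bar> \<le> int n"
  shows "act n w (bvec i) = bvec (w i)"
proof
  fix k
  have "act n w (bvec i) k = of_int (sgn i) * bvec (w \<bar>i\<bar>) k"
    using sum_bvec[OF assms(2,3), of "\<lambda>j. bvec (w (int j)) k"] by (simp add: act_def)
  then show "act n w (bvec i) k = bvec (w i) k"
    using signedD(2)[OF w, of i] assms(2) by (auto simp: abs_if bvec_uminus)
qed

lemma bvec_in_vecs: "1 \<le> \<bar>i\<bar> \<Longrightarrow> \<bar>i\<bar> \<le> int n \<Longrightarrow> bvec i \<in> vecs n"
  by (auto simp: vecs_def bvec_def)

lemma act_inject:
  assumes "w \<in> signed {1..int n}" "v \<in> signed {1..int n}" "\<And>u. u \<in> vecs n \<Longrightarrow> act n w u = act n v u"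
  shows "w = v"
proof
  fix i
  show "w i = v i"
  proof (cases "\<bar>i\<bar> \<in> {1..int n}")
    case True
    then have "bvec (w i) = bvec (v i)"
      using assms(3)[OF bvec_in_vecs, of i] act_bvec assms(1,2) by auto
    then show ?thesis by (simp add: bvec_inject)
  next
    case False
    then have "i \<notin> {1..int n} \<union> uminus ` {1..int n}" by (subst in_pm_iff) auto
    then show ?thesis using permutes_not_in[OF signedD(1)] assms(1,2) by metis
  qed
qed

text \<open>Coordinate k of the image comes from the index that s sends to k up to sign; for an
  involution this index is \<open>\<bar>s k\<bar>\<close>, so no inverse appears.\<close>

lemma act_signed_invs:
  assumes s: "s \<in> signed_invs {1..int n}" and v: "v \<in> vecs n"
  shows "act n s v k = of_int (sgn (s (int k))) * v (nat \<bar>s (int k)\<bar>)"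
proof -
  have s': "s \<in> signed {1..int n}" and inv: "s (s i) = i" for i
    using s by (auto simp: signed_invs_def fun_eq_iff)
  show ?thesis
  proof (cases "k \<in> {1..n}")
    case True
    define r where "r = nat \<bar>s (int k)\<bar>"
    have r: "1 \<le> r" "r \<le> n" "int r = \<bar>s (int k)\<bar>"
      using signed_interval_abs[OF s', of "int k"] True by (auto simp: r_def)
    have "act n s v k = (\<Sum>i=1..n. if i = r then v i * of_int (sgn (s (int k))) else 0)"
      unfolding act_def
    proof (rule sum.cong)
      fix i assume "i \<in> {1..n}"
      have "\<bar>int i\<bar> = \<bar>s (int k)\<bar> \<longleftrightarrow> \<bar>s (int i)\<bar> = \<bar>int k\<bar>"
        using signed_abs_eq_iff[OF s', of "s (int i)" "int k"] unfolding inv .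
      then have "int k = \<bar>s (int i)\<bar> \<longleftrightarrow> i = r"
        unfolding r(3)[symmetric] by (simp add: eq_commute)
      moreover have "sgn (s (int i)) = sgn (s (int k))" if "i = r"
      proof (cases "s (int k) > 0")
        case True
        then have "int i = s (int k)" using that r(3) by linarith
        then have "s (int i) = int k" using inv by simp
        then show ?thesis using True \<open>k \<in> {1..n}\<close> by simp
      next
        case False
        then have *: "int i = - s (int k)" using that r(3) by linarith
        have "s (int i) = - int k" unfolding * signedD(2)[OF s'] inv ..
        moreover have "s (int k) \<noteq> 0" using r(1,3) by linarith
        ultimately show ?thesis using False \<open>k \<in> {1..n}\<close> by (simp add: sgn_if)
      qed
      ultimately show "v i * bvec (s (int i)) k = (if i = r then v i * of_int (sgn (s (int k))) else 0)"
        by (simp add: bvec_def)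
    qed simp
    then show ?thesis using r by (simp add: r_def[symmetric])
  next
    case False
    have "\<bar>int k\<bar> \<notin> {1..int n}" using False by auto
    then have "s (int k) = int k" using s by (subst (asm) signed_invs_altdef) auto
    moreover have "v k = 0" using v False by (auto simp: vecs_def)
    moreover have "bvec (s (int i)) k = 0" if "i \<in> {1..n}" for i
      using signed_interval_abs[OF s', of "int i"] that False by (auto simp: bvec_def)
    ultimately show ?thesis by (simp add: act_def)
  qed
qed

lemma ip_diff: "ip n u (v - w) = ip n u v - ip n u w"
  by (simp add: ip_def right_diff_distrib sum_subtractf)

lemma ip_bvec: "1 \<le> \<bar>i\<bar> \<Longrightarrow> \<bar>i\<bar> \<le> int n \<Longrightarrow> ip n v (bvec i) = of_int (sgn i) * v (nat \<bar>i\<bar>)"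
  using sum_bvec[of i n v] by (simp add: ip_def mult.commute)

text \<open>For negative k the vector \<open>bvec m - bvec k\<close> is the sum of two standard
  basis vectors, so this covers both kinds of D-roots.\<close>

lemma act_swap_in:
  assumes "1 \<le> m" "m \<le> int n" "1 \<le> \<bar>k\<bar>" "\<bar>k\<bar> \<le> int n" "\<bar>k\<bar> \<noteq> m" "v \<in> vecs n"
  shows "act n (swap_in m k id) v = reflection n (bvec m - bvec k) v"
proof
  fix j
  define a where "a = bvec m - bvec k"
  have sg: "sgn k * sgn k = 1" using assms(3) by (auto simp: sgn_if)
  have ipa: "ip n u a = u (nat m) - of_int (sgn k) * u (nat \<bar>k\<bar>)" for u
    using assms by (simp add: a_def ip_diff ip_bvec)
  have "ip n a a = 2"
    using assms sg by (auto simp: ipa) (auto simp: a_def bvec_def sgn_if)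
  then have "reflection n a v j = v j - (v (nat m) - of_int (sgn k) * v (nat \<bar>k\<bar>)) * a j"
    by (simp add: reflection_def ipa)
  moreover have "act n (swap_in m k id) v j =
      of_int (sgn (swap_in m k id (int j))) * v (nat \<bar>swap_in m k id (int j)\<bar>)"
    using act_signed_invs[OF swap_in_id] assms by blast
  \<comment> \<open>At j = 0 the factor sgn 0 makes the image coordinate vanish, so the formula
    needs v to vanish there as well.\<close>
  moreover have "v 0 = 0" using assms(6) by (simp add: vecs_def)
  moreover have "of_int (sgn (swap_in m k id (int j))) * v (nat \<bar>swap_in m k id (int j)\<bar>) =
      v j - (v (nat m) - of_int (sgn k) * v (nat \<bar>k\<bar>)) * a j"
  proof -
    consider "int j = m" | "int j = \<bar>k\<bar>" "int j \<noteq> m" | "int j \<noteq> m" "int j \<noteq> \<bar>k\<bar>" by blast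
    then show ?thesis
    proof cases
      case 1
      then have "j = nat m" "a j = 1" using assms by (auto simp: a_def bvec_def)
      moreover have "swap_in m k id (int j) = k" using 1 by (simp add: swap_in_def)
      ultimately show ?thesis by simp
    next
      case 2
      then have j: "j = nat \<bar>k\<bar>" "a j = - of_int (sgn k)" using assms by (auto simp: a_def bvec_def)
      have "swap_in m k id (int j) = sgn k * m" using 2 assms by (auto simp: swap_in_def sgn_if abs_if)
      then show ?thesis using assms(1,3) j by (auto simp: sgn_if)
    next
      case 3
      then have "a j = 0" using assms(1) by (simp add: a_def bvec_def)
      moreover have "swap_in m k id (int j) = int j" using 3 assms by (auto simp: swap_in_def)
      ultimately show ?thesis using \<open>v 0 = 0\<close> by (cases "j = 0") auto
    qed
  qed
  ultimately show "act n (swap_in m k id) v j = reflection n (bvec m - bvec k) v j"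
    by (simp add: a_def)
qed

lemma act_swap_in_neg:
  assumes "1 \<le> n" "v \<in> vecs n"
  shows "act n (swap_in 1 (- 1) id) v = reflection n (bvec 1) v"
proof
  fix j
  have ipa: "ip n u (bvec 1) = u 1" for u
    using assms by (simp add: ip_bvec)
  then have "ip n (bvec 1) (bvec 1) = 1"
    unfolding ipa by (simp add: bvec_def)
  then have "reflection n (bvec 1) v j = v j - 2 * v 1 * bvec 1 j"
    by (simp add: reflection_def ipa)
  moreover have "act n (swap_in 1 (- 1) id) v j =
      of_int (sgn (swap_in 1 (- 1) id (int j))) * v (nat \<bar>swap_in 1 (- 1) id (int j)\<bar>)"
    using act_signed_invs[OF swap_in_id] assms by simp
  moreover have "v 0 = 0" using assms(2) by (simp add: vecs_def)
  ultimately show "act n (swap_in 1 (- 1) id) v j = reflection n (bvec 1) v j"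
    by (cases "j = 1") (auto simp: bvec_def swap_in_def sgn_if)
qed

lemma refls_in_Un: "refls_in n G (R \<union> R') = refls_in n G R \<union> refls_in n G R'"
  by (auto simp: refls_in_def)

text \<open>By faithfulness of the action (\<open>act_inject\<close>), \<open>s i\<close> is the
  only element of G acting as the reflection in \<open>r i\<close>.\<close>

lemma refls_in_image:
  assumes "carrier G \<subseteq> signed {1..int n}" "\<And>i. i \<in> I \<Longrightarrow> s i \<in> carrier G"
    and "\<And>i v. i \<in> I \<Longrightarrow> v \<in> vecs n \<Longrightarrow> act n (s i) v = reflection n (r i) v"
  shows "refls_in n G (r ` I) = s ` I"
proof (intro equalityI subsetI)
  fix t assume "t \<in> refls_in n G (r ` I)"
  then obtain i where "i \<in> I" "t \<in> carrier G" "\<And>v. v \<in> vecs n \<Longrightarrow> act n t v = reflection n (r i) v"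
    by (auto simp: refls_in_def)
  moreover from this have "t = s i"
    using assms by (intro act_inject[of t n "s i"]) auto
  ultimately show "t \<in> s ` I" by blast
next
  fix t assume "t \<in> s ` I"
  then show "t \<in> refls_in n G (r ` I)" using assms(2,3) by (auto simp: refls_in_def)
qed

lemma swap_in_signed: "1 \<le> m \<Longrightarrow> m \<le> int n \<Longrightarrow> 1 \<le> \<bar>k\<bar> \<Longrightarrow> \<bar>k\<bar> \<le> int n \<Longrightarrow>
  swap_in m k id \<in> signed {1..int n}"
  using swap_in_id by (simp add: signed_invs_def)

lemma negs_swap_in:
  "1 \<le> i \<Longrightarrow> i < int n \<Longrightarrow> negs {1..int n} (swap_in (i + 1) i id) = 0"
  "2 \<le> n \<Longrightarrow> even (negs {1..int n} (swap_in 2 (- 1) id))"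
  using negs_comp_swap_in[of i n id] even_negs_comp_swap_in[OF id_signed, of n] by simp_all

lemma refls_in_W_B:
  assumes "1 \<le> n"
  shows "refls_in n (W_B n) (simple_B n) =
    insert (swap_in 1 (- 1) id) ((\<lambda>i. swap_in (i + 1) i id) ` {1..<int n})"
proof -
  have "refls_in n (W_B n) ((\<lambda>_. bvec 1) ` {()}) = (\<lambda>_. swap_in 1 (- 1) id) ` {()}"
    using assms by (intro refls_in_image) (auto simp: carrier_W_B swap_in_signed act_swap_in_neg)
  moreover have "refls_in n (W_B n) ((\<lambda>i. bvec (i + 1) - bvec i) ` {1..<int n}) =
      (\<lambda>i. swap_in (i + 1) i id) ` {1..<int n}"
    using assms by (intro refls_in_image) (auto simp: carrier_W_B swap_in_signed act_swap_in)
  moreover have "simple_B n = {bvec 1} \<union> (\<lambda>i. bvec (i + 1) - bvec i) ` {1..<int n}"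
    by (auto simp: simple_B_def)
  ultimately show ?thesis by (simp only: refls_in_Un) simp
qed

lemma refls_in_W_D:
  assumes "2 \<le> n"
  shows "refls_in n (W_D n) (simple_D n) =
    insert (swap_in 2 (- 1) id) ((\<lambda>i. swap_in (i + 1) i id) ` {1..<int n})"
proof -
  have "refls_in n (W_D n) ((\<lambda>_. bvec 1 + bvec 2) ` {()}) = (\<lambda>_. swap_in 2 (- 1) id) ` {()}"
    using assms act_swap_in[of 2 n "- 1"]
    by (intro refls_in_image) (auto simp: carrier_W_D swap_in_signed negs_swap_in bvec_uminus add.commute)
  moreover have "refls_in n (W_D n) ((\<lambda>i. bvec (i + 1) - bvec i) ` {1..<int n}) =
      (\<lambda>i. swap_in (i + 1) i id) ` {1..<int n}"
    using assms by (intro refls_in_image) (auto simp: carrier_W_D swap_in_signed act_swap_in negs_swap_in)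
  moreover have "simple_D n = {bvec 1 + bvec 2} \<union> (\<lambda>i. bvec (i + 1) - bvec i) ` {1..<int n}"
    using assms by (auto simp: simple_D_def)
  ultimately show ?thesis by (simp only: refls_in_Un) simp
qed


section \<open>Coxeter lengths\<close>

abbreviation swap_adj :: "int \<Rightarrow> int \<Rightarrow> int" where
  "swap_adj i \<equiv> swap_in (i + 1) i id"

lemma D_len_comp_swap_adj:
  assumes x: "x \<in> signed {1..int n}" and i: "1 \<le> i" "i < int n"
  shows "D_len {1..int n} (x \<circ> swap_adj i) \<le> Suc (D_len {1..int n} x)"
    and "x (i + 1) < x i \<Longrightarrow> D_len {1..int n} (x \<circ> swap_adj i) < D_len {1..int n} x"
proof -
  have "\<bar>x i\<bar> \<noteq> \<bar>x (i + 1)\<bar>" using i signed_abs_eq_iff[OF x] by auto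
  from D_neg_commute[OF this] D_len_comp_swap_in[OF x i, of 1]
  show "D_len {1..int n} (x \<circ> swap_adj i) \<le> Suc (D_len {1..int n} x)"
    and "x (i + 1) < x i \<Longrightarrow> D_len {1..int n} (x \<circ> swap_adj i) < D_len {1..int n} x"
    by auto
qed

lemma D_len_comp_swap_neg:
  assumes x: "x \<in> signed {1..int n}" and n: "2 \<le> n"
  shows "D_len {1..int n} (x \<circ> swap_in 2 (- 1) id) \<le> Suc (D_len {1..int n} x)"
    and "x 1 + x 2 < 0 \<Longrightarrow> D_len {1..int n} (x \<circ> swap_in 2 (- 1) id) < D_len {1..int n} x"
proof -
  have "\<bar>x 1\<bar> \<noteq> \<bar>x 2\<bar>" using signed_abs_eq_iff[OF x] by auto
  from D_neg_commute[OF this] D_len_comp_swap_in[OF x, of 1 "- 1"] n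
  show "D_len {1..int n} (x \<circ> swap_in 2 (- 1) id) \<le> Suc (D_len {1..int n} x)"
    and "x 1 + x 2 < 0 \<Longrightarrow> D_len {1..int n} (x \<circ> swap_in 2 (- 1) id) < D_len {1..int n} x"
    using signedD(2)[OF x, of 1] signedD(2)[OF x, of 2] by auto
qed

lemma D_len_id [simp]: "D_len {1..int n} id = 0"
  by (auto simp: D_len_def D_neg_def intro!: sum.neutral)

lemma swap_in_involutive:
  "1 \<le> m \<Longrightarrow> m \<le> int n \<Longrightarrow> 1 \<le> \<bar>k\<bar> \<Longrightarrow> \<bar>k\<bar> \<le> int n \<Longrightarrow> swap_in m k id \<circ> swap_in m k id = id"
  using swap_in_id by (simp add: signed_invs_def)

lemma not_descent:
  assumes x: "x \<in> signed {1..int n}" "1 \<le> i" "i < int n" "\<not> x (i + 1) < x i"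
  shows "x i < x (i + 1)"
  using signedD(3)[OF x(1), of i "i + 1"] assms(4) by (simp add: order_le_less)

lemma word_length_W_B:
  assumes "1 \<le> n" and x: "x \<in> signed {1..int n}"
  shows "word_length (W_B n) (refls_in n (W_B n) (simple_B n)) x =
    D_len {1..int n} x + negs {1..int n} x"
proof (rule word_length_eqI[where l = "\<lambda>x. D_len {1..int n} x + negs {1..int n} x"])
  show "monoid (W_B n)" by (rule monoid_W_B)
  show "refls_in n (W_B n) (simple_B n) \<subseteq> carrier (W_B n)" by (auto simp: refls_in_def)
  show "x \<in> carrier (W_B n)" using x by (simp add: carrier_W_B)
next
  fix x s assume "x \<in> carrier (W_B n)" and s: "s \<in> refls_in n (W_B n) (simple_B n)"
  then have x: "x \<in> signed {1..int n}" by (simp add: carrier_W_B)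
  from s consider "s = swap_in 1 (- 1) id" | i where "1 \<le> i" "i < int n" "s = swap_adj i"
    unfolding refls_in_W_B[OF assms(1)] by auto
  then show "D_len {1..int n} (x \<otimes>\<^bsub>W_B n\<^esub> s) + negs {1..int n} (x \<otimes>\<^bsub>W_B n\<^esub> s) \<le>
      Suc (D_len {1..int n} x + negs {1..int n} x)"
  proof cases
    case 1
    then show ?thesis using comp_swap_in_neg(1,3)[OF x assms(1)] by simp
  next
    case 2
    then show ?thesis using D_len_comp_swap_adj(1)[OF x] by (simp add: negs_comp_swap_in)
  qed
next
  fix x assume "x \<in> carrier (W_B n)" "x \<noteq> \<one>\<^bsub>W_B n\<^esub>"
  then have x: "x \<in> signed {1..int n}" "x \<noteq> id" by (simp_all add: carrier_W_B)
  have "x 1 \<noteq> 0" using signed_eq_0_iff[OF x(1)] by simp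
  with signed_no_descent[OF x(1)] x(2) not_descent[OF x(1)]
  consider i where "1 \<le> i" "i < int n" "x (i + 1) < x i" | "x 1 < 0"
    by (metis linorder_neqE)
  then show "\<exists>s\<in>refls_in n (W_B n) (simple_B n). s \<otimes>\<^bsub>W_B n\<^esub> s = \<one>\<^bsub>W_B n\<^esub> \<and>
      D_len {1..int n} (x \<otimes>\<^bsub>W_B n\<^esub> s) + negs {1..int n} (x \<otimes>\<^bsub>W_B n\<^esub> s) <
      D_len {1..int n} x + negs {1..int n} x"
  proof cases
    case 1
    then have "swap_adj i \<in> refls_in n (W_B n) (simple_B n)"
      by (auto simp: refls_in_W_B[OF assms(1)])
    then show ?thesis
      using D_len_comp_swap_adj(2)[OF x(1) 1] swap_in_involutive[of "i + 1" n i] 1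
      by (intro bexI[of _ "swap_adj i"]) (simp_all add: negs_comp_swap_in)
  next
    case 2
    have "swap_in 1 (- 1) id \<in> refls_in n (W_B n) (simple_B n)"
      by (simp add: refls_in_W_B[OF assms(1)])
    then show ?thesis
      using comp_swap_in_neg(1,2)[OF x(1) assms(1)] swap_in_involutive[of 1 n "- 1"] assms(1) 2
      by (intro bexI[of _ "swap_in 1 (- 1) id"]) simp_all
  qed
qed simp

lemma word_length_W_D:
  assumes "1 \<le> n" and x: "x \<in> carrier (W_D n)"
  shows "word_length (W_D n) (refls_in n (W_D n) (simple_D n)) x = D_len {1..int n} x"
proof (rule word_length_eqI[where l = "D_len {1..int n}"])
  show "monoid (W_D n)" by (rule monoid_W_D)
  show "refls_in n (W_D n) (simple_D n) \<subseteq> carrier (W_D n)" by (auto simp: refls_in_def)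
  show "x \<in> carrier (W_D n)" by (rule x)
next
  fix x s assume "x \<in> carrier (W_D n)" and s: "s \<in> refls_in n (W_D n) (simple_D n)"
  then have x: "x \<in> signed {1..int n}" by (simp add: carrier_W_D)
  \<comment> \<open>D_1 has no simple roots, so the mere existence of a generator excludes n =
    1.\<close>
  have n: "2 \<le> n" using s by (rule contrapos_pp) (simp add: refls_in_def simple_D_def)
  from s consider "s = swap_in 2 (- 1) id" | i where "1 \<le> i" "i < int n" "s = swap_adj i"
    unfolding refls_in_W_D[OF n] by auto
  then show "D_len {1..int n} (x \<otimes>\<^bsub>W_D n\<^esub> s) \<le> Suc (D_len {1..int n} x)"
  proof cases
    case 1
    then show ?thesis using D_len_comp_swap_neg(1)[OF x n] by simp
  next
    case 2
    then show ?thesis using D_len_comp_swap_adj(1)[OF x] by simp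
  qed
next
  fix x assume "x \<in> carrier (W_D n)" "x \<noteq> \<one>\<^bsub>W_D n\<^esub>"
  then have x: "x \<in> signed {1..int n}" "x \<noteq> id" "even (negs {1..int n} x)"
    by (simp_all add: carrier_W_D)
  have "\<bar>x 1\<bar> \<noteq> \<bar>x 2\<bar>" using signed_abs_eq_iff[OF x(1)] by simp
  then have ne: "x 1 + x 2 < 0" if "\<not> x 1 + x 2 > 0" using that by linarith
  have "2 \<le> n \<and> x 1 + x 2 < 0 \<or> (\<exists>i. 1 \<le> i \<and> i < int n \<and> x (i + 1) < x i)"
  proof (rule ccontr)
    assume neg: "\<not> ?thesis"
    have "x 1 + x 2 > 0"
    proof (cases "2 \<le> n")
      \<comment> \<open>Here n = 1: the index 2 lies outside the range, so x 2 = 2 exceeds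
        \<open>\<bar>x 1\<bar> = 1\<close>.\<close>
      case False
      then have "x 2 = 2"
        using permutes_not_in[OF signedD(1)[OF x(1)], of 2]
        unfolding in_pm_iff[OF atLeastAtMost_pos] by simp
      moreover have "\<bar>x 1\<bar> = 1" using signed_interval_abs[OF x(1), of 1] False assms(1) by simp
      ultimately show ?thesis by simp
    qed (use ne neg in auto)
    then show False
      using signed_no_descent[OF x(1)] not_descent[OF x(1)] x(2,3) neg by blast
  qed
  then consider i where "1 \<le> i" "i < int n" "x (i + 1) < x i" | "x 1 + x 2 < 0" "2 \<le> n"
    by blast
  then show "\<exists>s\<in>refls_in n (W_D n) (simple_D n). s \<otimes>\<^bsub>W_D n\<^esub> s = \<one>\<^bsub>W_D n\<^esub> \<and>
      D_len {1..int n} (x \<otimes>\<^bsub>W_D n\<^esub> s) < D_len {1..int n} x"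
  proof cases
    case 1
    then have "swap_adj i \<in> refls_in n (W_D n) (simple_D n)"
      using refls_in_W_D[of n] by auto
    then show ?thesis
      using D_len_comp_swap_adj(2)[OF x(1) 1] swap_in_involutive[of "i + 1" n i] 1
      by (intro bexI[of _ "swap_adj i"]) simp_all
  next
    case 2
    then have "swap_in 2 (- 1) id \<in> refls_in n (W_D n) (simple_D n)"
      using refls_in_W_D[of n] by auto
    then show ?thesis
      using D_len_comp_swap_neg(2)[OF x(1) 2(2,1)] swap_in_involutive[of 2 n "- 1"] 2
      by (intro bexI[of _ "swap_in 2 (- 1) id"]) simp_all
  qed
qed simp

section \<open>Counting the roots sent to negative roots\<close>

definition height :: "nat \<Rightarrow> (nat \<Rightarrow> real) \<Rightarrow> real" where
  "height n v = (\<Sum>k=1..n. v k * real k)"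

lemma height_simps:
  "height n (u + v) = height n u + height n v" "height n (u - v) = height n u - height n v"
  "height n (- v) = - height n v"
  by (simp_all add: height_def distrib_right left_diff_distrib sum.distrib sum_subtractf sum_negf)

lemma height_bvec: "1 \<le> \<bar>i\<bar> \<Longrightarrow> \<bar>i\<bar> \<le> int n \<Longrightarrow> height n (bvec i) = of_int i"
  using sum_bvec[of i n real] by (auto simp: height_def sgn_if abs_if)

text \<open>\<open>height\<close> is linear with \<open>bvec i\<close> mapped to i, so e_j - e_i,
  e_j + e_i (i < j) and e_i all get positive values. It certifies that a vector is not the negative
  of a positive root.\<close>

lemma height_pos_B: "a \<in> pos_B n \<Longrightarrow> height n a > 0"
  by (auto simp: pos_B_def pos_D_def height_simps height_bvec)

lemma pos_BI:
  assumes "1 \<le> i" "i < j" "j \<le> int n"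
  shows "bvec j - bvec i \<in> pos_B n" "bvec j + bvec i \<in> pos_B n"
  using assms unfolding pos_B_def pos_D_def by blast+

text \<open>One direction is read off from the height. Conversely, if p + q < 0 then the entry of
  larger absolute value is negative, and the sign of the other one selects the difference or the sum
  of basis vectors.\<close>

lemma bvec_add_neg_iff:
  assumes "1 \<le> \<bar>p\<bar>" "\<bar>p\<bar> \<le> int n" "1 \<le> \<bar>q\<bar>" "\<bar>q\<bar> \<le> int n" "\<bar>p\<bar> \<noteq> \<bar>q\<bar>"
  shows "- (bvec p + bvec q) \<in> pos_B n \<longleftrightarrow> p + q < 0"
proof
  assume "- (bvec p + bvec q) \<in> pos_B n"
  from height_pos_B[OF this] show "p + q < 0"
    using assms by (simp add: height_simps height_bvec)
next
  have *: "- (bvec p + bvec q) \<in> pos_B n"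
    if "\<bar>p\<bar> < \<bar>q\<bar>" "1 \<le> \<bar>p\<bar>" "\<bar>q\<bar> \<le> int n" "p + q < 0" for p q
  proof (cases "p > 0")
    case True
    have "- (bvec p + bvec q) = bvec (- q) - bvec p" by (simp add: bvec_uminus)
    also have "\<dots> \<in> pos_B n" by (rule pos_BI) (use that True in auto)
    finally show ?thesis .
  next
    case False
    have "- (bvec p + bvec q) = bvec (- q) + bvec (- p)" by (simp add: bvec_uminus)
    also have "\<dots> \<in> pos_B n" by (rule pos_BI) (use that False in auto)
    finally show ?thesis .
  qed
  assume "p + q < 0"
  then show "- (bvec p + bvec q) \<in> pos_B n"
    using *[of p q] *[of q p] assms unfolding add.commute[of q p] add.commute[of "bvec q" "bvec p"]
    by linarith
qed

lemma card_Lam: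
  assumes x: "x \<in> signed {1..int n}"
  shows "card (Lam n x) = D_len {1..int n} x"
proof -
  define P where "P = {(i, j). i \<in> {1..int n} \<and> j \<in> {1..int n} \<and> i < j}"
  define R where "R = (\<lambda>(i, j). {a \<in> {bvec j - bvec i, bvec j + bvec i}. - act n x a \<in> pos_B n})"
  have finP: "finite P"
    by (rule finite_subset[of _ "{1..int n} \<times> {1..int n}"]) (auto simp: P_def)
  have Lam: "Lam n x = (\<Union>p\<in>P. R p)"
  proof (intro equalityI subsetI)
    fix a assume "a \<in> Lam n x"
    then obtain i j where "1 \<le> i" "i < j" "j \<le> int n" "a = bvec j - bvec i \<or> a = bvec j + bvec i"
      and neg: "- act n x a \<in> pos_B n"
      unfolding Lam_def pos_D_def by blast
    then have "(i, j) \<in> P" "a \<in> R (i, j)" by (auto simp: P_def R_def)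
    then show "a \<in> (\<Union>p\<in>P. R p)" by blast
  qed (auto simp: Lam_def R_def P_def pos_D_def)
  \<comment> \<open>The support of a root recovers its pair of indices, so different pairs
    contribute disjoint sets of roots.\<close>
  have supp: "{k. a k \<noteq> 0} = {nat i, nat j}" if "(i, j) \<in> P" "a \<in> R (i, j)" for i j a
    using that by (auto simp: P_def R_def bvec_def split: if_splits)
  have disj: "R p \<inter> R q = {}" if "p \<in> P" "q \<in> P" "p \<noteq> q" for p q
  proof (rule ccontr)
    assume "R p \<inter> R q \<noteq> {}"
    then obtain a where a: "a \<in> R p" "a \<in> R q" by blast
    obtain i j i' j' where eq: "p = (i, j)" "q = (i', j')" by fastforce
    have "{nat i, nat j} = {nat i', nat j'}" using supp that a unfolding eq by metis
    moreover have "1 \<le> i" "i < j" "1 \<le> i'" "i' < j'" using that by (auto simp: eq P_def)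
    ultimately have "i = i' \<and> j = j'" unfolding doubleton_eq_iff by linarith
    then show False using that(3) eq by simp
  qed
  have card: "card (R (i, j)) = D_neg (x i) (x j)" if "(i, j) \<in> P" for i j
  proof -
    have ij: "1 \<le> i" "i < j" "j \<le> int n" using that by (auto simp: P_def)
    have xi: "1 \<le> \<bar>x i\<bar>" "\<bar>x i\<bar> \<le> int n" "1 \<le> \<bar>x j\<bar>" "\<bar>x j\<bar> \<le> int n"
      using signed_interval_abs[OF x] ij by auto
    have ne: "\<bar>x i\<bar> \<noteq> \<bar>x j\<bar>" using signed_abs_eq_iff[OF x] ij by auto
    have "act n x (bvec j + bvec i) = bvec (x j) + bvec (x i)"
      using ij by (simp add: act_add act_bvec[OF x])
    then have A: "- act n x (bvec j + bvec i) \<in> pos_B n \<longleftrightarrow> x j + x i < 0"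
      using bvec_add_neg_iff[of "x j" n "x i"] xi ne by simp
    have "act n x (bvec j - bvec i) = bvec (x j) + bvec (- x i)"
      using ij by (simp add: act_diff act_bvec[OF x] bvec_uminus)
    then have B: "- act n x (bvec j - bvec i) \<in> pos_B n \<longleftrightarrow> x j < x i"
      using bvec_add_neg_iff[of "x j" n "- x i"] xi ne by simp
    \<comment> \<open>The two roots of a pair differ at coordinate i, where they are -1 and 1; hence
      they are counted separately.\<close>
    have "(bvec j - bvec i) (nat i) \<noteq> (bvec j + bvec i) (nat i)"
      using ij by (simp add: bvec_def)
    then have "bvec j - bvec i \<noteq> bvec j + bvec i" by metis
    moreover have "R (i, j) = (if x j < x i then {bvec j - bvec i} else {}) \<union>
      (if x j + x i < 0 then {bvec j + bvec i} else {})"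
      using A B by (auto simp: R_def)
    ultimately show ?thesis using ne xi by (auto simp: D_neg_def)
  qed
  have "card (Lam n x) = (\<Sum>p\<in>P. card (R p))"
    unfolding Lam using finP disj by (intro card_UN_disjoint) (auto simp: R_def)
  also have "\<dots> = D_len {1..int n} x"
    unfolding D_len_def P_def[symmetric] by (intro sum.cong) (auto simp: card)
  finally show ?thesis .
qed

section \<open>Involution polynomials as values of \<open>inv_rec\<close>\<close>

lemma inv_sum_interval: "inv_sum f {1..int n} = inv_rec f n"
  using inv_sum_eq_inv_rec[of "{1..int n}" f] by simp

lemma L_B_eq:
  assumes "1 \<le> n"
  shows "L_B n = inv_rec (\<lambda>a b. Polynomial.monom 1 (a + b)) n"
proof -
  have "L_B n = inv_sum (\<lambda>a b. Polynomial.monom 1 (a + b)) {1..int n}"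
    unfolding L_B_def inv_poly_def inv_sum_def
    by (intro sum.cong) (auto simp: carrier_W_B signed_invs_def word_length_W_B[OF assms])
  then show ?thesis by (simp only: inv_sum_interval)
qed

text \<open>Membership in W(D_n) is a parity condition on \<open>negs\<close>; setting the weight to
  0 at odd b moves it from the range of summation into f.\<close>

lemma L_D_eq:
  assumes "1 \<le> n"
  shows "L_D n = inv_rec (\<lambda>a b. if even b then Polynomial.monom 1 a else 0) n"
proof -
  have "L_D n = inv_sum (\<lambda>a b. if even b then Polynomial.monom 1 a else 0) {1..int n}"
    unfolding L_D_def inv_poly_def inv_sum_def
    using finite_signed_invs[of "{1..int n}"]
    by (intro sum.mono_neutral_cong_left)
      (auto simp: carrier_W_D signed_invs_def word_length_W_D[OF assms])
  then show ?thesis by (simp only: inv_sum_interval)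
qed

lemma L_BD_eq: "L_BD n = inv_rec (\<lambda>a b. if odd b then Polynomial.monom 1 a else 0) n"
proof -
  have "L_BD n = inv_sum (\<lambda>a b. if odd b then Polynomial.monom 1 a else 0) {1..int n}"
    unfolding L_BD_def inv_sum_def
    using finite_signed_invs[of "{1..int n}"]
    by (intro sum.mono_neutral_cong_left)
      (auto simp: carrier_W_B carrier_W_D signed_invs_def card_Lam)
  then show ?thesis by (simp only: inv_sum_interval)
qed

section \<open>Symmetric groups as signed permutations\<close>

text \<open>This embeds the symmetric group into the signed permutations and takes adjacent
  transpositions to \<open>swap_adj\<close>, so the length bounds and the descent criterion carry
  over.\<close>

definition odd_ext :: "(nat \<Rightarrow> nat) \<Rightarrow> int \<Rightarrow> int" where
  "odd_ext w i = (if i \<ge> 0 then int (w (nat i)) else - int (w (nat (- i))))"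

lemma odd_ext_int [simp]: "odd_ext w (int k) = int (w k)"
  by (simp add: odd_ext_def)

lemma odd_ext_uminus: "w 0 = 0 \<Longrightarrow> odd_ext w (- i) = - odd_ext w i"
  by (simp add: odd_ext_def)

lemma odd_ext_comp:
  assumes "v 0 = 0"
  shows "odd_ext (v \<circ> w) = odd_ext v \<circ> odd_ext w"
proof
  fix i
  show "odd_ext (v \<circ> w) i = (odd_ext v \<circ> odd_ext w) i"
    using assms by (cases "w (nat (- i)) = 0") (auto simp: odd_ext_def)
qed


lemma odd_ext_id [simp]: "odd_ext id = id"
  by (auto simp: odd_ext_def)

lemma bij_fixing_imp_permutes: "bij f \<Longrightarrow> (\<And>x. x \<notin> S \<Longrightarrow> f x = x) \<Longrightarrow> f permutes S"
  by (simp add: permutes_def bij_iff)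

lemma odd_ext_signed:
  assumes w: "w permutes {1..n}"
  shows "odd_ext w \<in> signed {1..int n}"
proof -
  have w0: "w 0 = 0" "Hilbert_Choice.inv w 0 = 0"
    using permutes_not_in[OF w] permutes_not_in[OF permutes_inv[OF w]] by auto
  have "odd_ext w \<circ> odd_ext (Hilbert_Choice.inv w) = id" "odd_ext (Hilbert_Choice.inv w) \<circ> odd_ext w = id"
    using odd_ext_comp[of w "Hilbert_Choice.inv w"] odd_ext_comp[of "Hilbert_Choice.inv w" w] w0
      permutes_inv_o[OF w] by simp_all
  then have "bij (odd_ext w)" by (rule o_bij[rotated])
  moreover have "odd_ext w i = i" if "i \<notin> {1..int n} \<union> uminus ` {1..int n}" for i
  proof -
    have "nat \<bar>i\<bar> \<notin> {1..n}" using that unfolding in_pm_iff[OF atLeastAtMost_pos] by auto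
    then have "w (nat \<bar>i\<bar>) = nat \<bar>i\<bar>" by (rule permutes_not_in[OF w])
    then show ?thesis by (auto simp: odd_ext_def abs_if split: if_splits)
  qed
  ultimately have "odd_ext w permutes ({1..int n} \<union> uminus ` {1..int n})"
    by (rule bij_fixing_imp_permutes)
  then show ?thesis
    using w0 by (simp add: signed_def odd_ext_uminus)
qed

lemma negs_odd_ext [simp]: "negs {1..int n} (odd_ext w) = 0"
  by (auto simp: negs_def odd_ext_def)

lemma odd_ext_inject: "odd_ext v = odd_ext w \<longleftrightarrow> v = w"
  by (metis odd_ext_int of_nat_eq_iff ext)

lemma odd_ext_transpose:
  "1 \<le> k \<Longrightarrow> odd_ext (Transposition.transpose k (Suc k)) = swap_adj (int k)"
  by (auto simp: odd_ext_def swap_in_def Transposition.transpose_def fun_eq_iff nat_eq_iff)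

lemma word_length_A:
  assumes w: "w permutes {1..n + 1}"
  shows "word_length (sym_group (n + 1)) (refls_A n) w = D_len {1..int (n + 1)} (odd_ext w)"
proof (rule word_length_eqI[where l = "\<lambda>w. D_len {1..int (n + 1)} (odd_ext w)"])
  show "monoid (sym_group (n + 1))"
    by (simp add: sym_group_is_group group.is_monoid)
  show "refls_A n \<subseteq> carrier (sym_group (n + 1))"
    by (auto simp: refls_A_def sym_group_def intro!: permutes_swap_id)
  show "w \<in> carrier (sym_group (n + 1))" using w by (simp add: sym_group_def)
  show "D_len {1..int (n + 1)} (odd_ext \<one>\<^bsub>sym_group (n + 1)\<^esub>) = 0"
    by (simp only: sym_group_def monoid.simps odd_ext_id D_len_id)
next
  fix w s assume "w \<in> carrier (sym_group (n + 1))" "s \<in> refls_A n"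
  then obtain k where w: "w permutes {1..n + 1}" and k: "1 \<le> k" "k \<le> n"
    and s: "s = Transposition.transpose k (Suc k)"
    by (auto simp: refls_A_def sym_group_def)
  have "w 0 = 0" using permutes_not_in[OF w] by simp
  then show "D_len {1..int (n + 1)} (odd_ext (w \<otimes>\<^bsub>sym_group (n + 1)\<^esub> s)) \<le>
      Suc (D_len {1..int (n + 1)} (odd_ext w))"
    using D_len_comp_swap_adj(1)[OF odd_ext_signed[OF w], of "int k"] k
    by (simp add: sym_group_def odd_ext_comp odd_ext_transpose s)
next
  fix w assume "w \<in> carrier (sym_group (n + 1))" "w \<noteq> \<one>\<^bsub>sym_group (n + 1)\<^esub>"
  then have w: "w permutes {1..n + 1}" "w \<noteq> id" by (auto simp: sym_group_def)
  have w0: "w 0 = 0" using permutes_not_in[OF w(1)] by simp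
  note x = odd_ext_signed[OF w(1)]
  have "odd_ext w \<noteq> id" using w(2) odd_ext_inject[of w id] by simp
  \<comment> \<open>Positive integers keep positive values, so the first alternative of
    \<open>signed_no_descent\<close> holds and a descent between neighbours must exist.\<close>
  moreover have "odd_ext w 1 > 0"
    using signed_eq_0_iff[OF x, of 1] by (auto simp: odd_ext_def)
  ultimately obtain i where i: "1 \<le> i" "i < int (n + 1)" "odd_ext w (i + 1) < odd_ext w i"
    using signed_no_descent[OF x] not_descent[OF x] by blast
  define k where "k = nat i"
  have k: "1 \<le> k" "k \<le> n" "int k = i" using i by (auto simp: k_def)
  have "Transposition.transpose k (k + 1) \<in> refls_A n" using k by (auto simp: refls_A_def)
  then show "\<exists>s\<in>refls_A n. s \<otimes>\<^bsub>sym_group (n + 1)\<^esub> s = \<one>\<^bsub>sym_group (n + 1)\<^esub> \<and>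
      D_len {1..int (n + 1)} (odd_ext (w \<otimes>\<^bsub>sym_group (n + 1)\<^esub> s)) <
      D_len {1..int (n + 1)} (odd_ext w)"
    using D_len_comp_swap_adj(2)[OF x i] k w0
    by (intro bexI[of _ "Transposition.transpose k (k + 1)"])
      (simp_all add: sym_group_def odd_ext_comp odd_ext_transpose)
qed

lemma odd_ext_image:
  "odd_ext ` {w. w permutes {1..n} \<and> w \<circ> w = id} = {x \<in> signed_invs {1..int n}. negs {1..int n} x = 0}"
proof (intro equalityI subsetI)
  fix x assume "x \<in> odd_ext ` {w. w permutes {1..n} \<and> w \<circ> w = id}"
  then obtain w where w: "w permutes {1..n}" "w \<circ> w = id" "x = odd_ext w" by blast
  have "w 0 = 0" using permutes_not_in[OF w(1)] by simp
  from odd_ext_comp[of w w, OF this] show "x \<in> {x \<in> signed_invs {1..int n}. negs {1..int n} x = 0}"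
    using w odd_ext_signed[OF w(1)] by (simp add: signed_invs_def)
next
  fix x assume "x \<in> {x \<in> signed_invs {1..int n}. negs {1..int n} x = 0}"
  then have x: "x \<in> signed {1..int n}" "\<And>i. x (x i) = i" and card: "card {i \<in> {1..int n}. x i < 0} = 0"
    by (auto simp: signed_invs_def negs_def fun_eq_iff)
  have "finite {i \<in> {1..int n}. x i < 0}"
    by (rule finite_subset[of _ "{1..int n}"]) auto
  with card have nonneg: "{i \<in> {1..int n}. x i < 0} = {}" by (simp only: card_0_eq)
  have fixed: "x i = i" if "\<bar>i\<bar> \<notin> {1..int n}" for i
    using that by (intro permutes_not_in[OF signedD(1)[OF x(1)]])
      (simp only: in_pm_iff[OF atLeastAtMost_pos] not_False_eq_True)
  have pos: "x i \<ge> 0" if "i \<ge> 0" for i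
    using that fixed[of i] nonneg by fastforce
  define w where "w k = nat (x (int k))" for k
  have "w (w k) = k" for k
    using pos[of "int k"] x(2) by (simp add: w_def)
  moreover have "w k = k" if "k \<notin> {1..n}" for k
    using fixed[of "int k"] that by (simp add: w_def)
  ultimately have "w \<circ> w = id" "w permutes {1..n}"
    by (auto intro!: bij_fixing_imp_permutes involuntory_imp_bij)
  moreover have "odd_ext w = x"
  proof
    show "odd_ext w i = x i" for i
      using pos[of i] pos[of "- i"] signedD(2)[OF x(1), of i] by (auto simp: odd_ext_def w_def)
  qed
  ultimately show "x \<in> odd_ext ` {w. w permutes {1..n} \<and> w \<circ> w = id}" by blast
qed

lemma L_A_eq: "L_A n = inv_rec (\<lambda>a b. if b = 0 then Polynomial.monom 1 a else 0) (n + 1)"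
proof -
  define X where "X = {1..int (n + 1)}"
  have "L_A n = (\<Sum>w | w permutes {1..n + 1} \<and> w \<circ> w = id. Polynomial.monom 1 (D_len X (odd_ext w)))"
    unfolding L_A_def inv_poly_def sym_group_carrier sym_group_mult sym_group_one X_def
    by (intro sum.cong arg_cong[of _ _ "Polynomial.monom 1"] word_length_A) auto
  also have "\<dots> = (\<Sum>x | x \<in> signed_invs X \<and> negs X x = 0. Polynomial.monom 1 (D_len X x))"
    unfolding X_def odd_ext_image[symmetric]
    by (subst sum.reindex) (auto simp: inj_on_def odd_ext_inject)
  also have "\<dots> = inv_sum (\<lambda>a b. if b = 0 then Polynomial.monom 1 a else 0) X"
    using finite_signed_invs[of X] by (auto simp: inv_sum_def X_def split: if_splits intro!: sum.mono_neutral_cong_left)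
  finally show ?thesis unfolding X_def by (simp only: inv_sum_interval)
qed


section \<open>The recursions\<close>

lemma inv_rec_mult:
  fixes f :: "nat \<Rightarrow> nat \<Rightarrow> 'a::comm_semiring_1"
  shows "inv_rec (\<lambda>a b. p * f a b) n = p * inv_rec f n"
proof (induction n arbitrary: f rule: less_induct)
  case (less n)
  have shift: "shift c d (\<lambda>a b. p * f a b) = (\<lambda>a b. p * shift c d f a b)" for c d
    by (simp add: shift_def fun_eq_iff)
  show ?case
    by (cases n) (simp_all add: shift less sum_distrib_left distrib_left)
qed

text \<open>g and h are what f becomes when the number of negative values grows by 1 or 2: zero in
  type A, t f and t^2 f in type B, the opposite parity and again f in type D.\<close>

lemma inv_rec_Suc_graded:
  fixes f :: "nat \<Rightarrow> nat \<Rightarrow> 'a::comm_ring_1"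
  assumes "\<And>c. shift c 0 f = (\<lambda>a b. t ^ c * f a b)"
    and "\<And>c. shift c 1 f = (\<lambda>a b. t ^ c * g a b)"
    and "\<And>c. shift c 2 f = (\<lambda>a b. t ^ c * h a b)"
  shows "inv_rec f (Suc n) = inv_rec f n + t ^ (2 * n) * inv_rec g n +
    t * (\<Sum>r<n. (t\<^sup>2) ^ r) * (inv_rec f (n - 1) + t ^ (2 * (n - 1)) * inv_rec h (n - 1))"
proof -
  have S1: "(\<Sum>r<n. t ^ (1 + 2 * (n - Suc r))) = t * (\<Sum>r<n. (t\<^sup>2) ^ r)"
    using sum.nat_diff_reindex[of "\<lambda>r. (t\<^sup>2) ^ r" n]
    by (simp add: sum_distrib_left[symmetric] power_mult)
  \<comment> \<open>Although the exponent mixes both ranks, it equals 1 + 2r + 2(n - 1): the same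
    geometric sum, moved by a constant power.\<close>
  have S2: "(\<Sum>r<n. t ^ (1 + 2 * (n - Suc r) + 4 * r)) =
      t * (\<Sum>r<n. (t\<^sup>2) ^ r) * t ^ (2 * (n - 1))"
    unfolding sum_distrib_left sum_distrib_right
  proof (rule sum.cong)
    fix r assume "r \<in> {..<n}"
    then have "1 + 2 * (n - Suc r) + 4 * r = 1 + 2 * r + 2 * (n - 1)" by auto
    then show "t ^ (1 + 2 * (n - Suc r) + 4 * r) = t * (t\<^sup>2) ^ r * t ^ (2 * (n - 1))"
      by (simp only: power_add power_mult power_one_right)
  qed simp
  have "inv_rec f (Suc n) = inv_rec f n + t ^ (2 * n) * inv_rec g n +
      ((\<Sum>r<n. t ^ (1 + 2 * (n - Suc r))) * inv_rec f (n - 1) +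
       (\<Sum>r<n. t ^ (1 + 2 * (n - Suc r) + 4 * r)) * inv_rec h (n - 1))"
    by (simp only: inv_rec.simps assms inv_rec_mult sum.distrib sum_distrib_right)
  then show ?thesis unfolding S1 S2 by (simp only: distrib_left mult.assoc)
qed

lemma monom_1_eq: "Polynomial.monom 1 k = (tvar ^ k :: int poly)"
  by (simp add: monom_altdef)

abbreviation geo :: "nat \<Rightarrow> int poly" where
  "geo n \<equiv> (\<Sum>r<n. (tvar\<^sup>2) ^ r)"

text \<open>The last factor stays an \<open>inv_rec\<close> because at n = 0 it belongs to the empty
  set of letters, one step below \<open>L_A 0\<close>.\<close>

lemma L_A_Suc: "L_A (Suc n) = L_A n + tvar * geo (Suc n) * inv_rec (\<lambda>a b. if b = 0 then tvar ^ a else 0) n"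
  \<comment> \<open>A nonzero shift of b annihilates the weight. Writing zero as
    \<open>0 * 0\<close> lets \<open>inv_rec_mult\<close> extract a factor 0.\<close>
  using inv_rec_Suc_graded[of "\<lambda>a b. if b = 0 then tvar ^ a else 0" tvar "\<lambda>a b. 0 * 0" "\<lambda>a b. 0 * 0" "Suc n"]
  unfolding L_A_eq monom_1_eq inv_rec_mult by (simp add: shift_def fun_eq_iff power_add)

lemma L_B_Suc: "1 \<le> n \<Longrightarrow> L_B (Suc n) = (1 + tvar ^ (2 * n + 1)) * L_B n +
    tvar * geo n * (1 + tvar ^ (2 * n)) * inv_rec (\<lambda>a b. tvar ^ (a + b)) (n - 1)"
  using inv_rec_Suc_graded[of "\<lambda>a b. tvar ^ (a + b)" tvar "\<lambda>a b. tvar * tvar ^ (a + b)"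
      "\<lambda>a b. tvar ^ 2 * tvar ^ (a + b)" n]
  unfolding L_B_eq[of n] L_B_eq[OF le_SucI] monom_1_eq inv_rec_mult
  by (cases n) (auto simp: shift_def fun_eq_iff power_add algebra_simps power2_eq_square)

lemma L_D_Suc: "1 \<le> n \<Longrightarrow> L_D (Suc n) = L_D n + tvar ^ (2 * n) * L_BD n +
    tvar * geo n * (1 + tvar ^ (2 * n - 2)) * inv_rec (\<lambda>a b. if even b then tvar ^ a else 0) (n - 1)"
  using inv_rec_Suc_graded[of "\<lambda>a b. if even b then tvar ^ a else 0" tvar
      "\<lambda>a b. if odd b then tvar ^ a else 0" "\<lambda>a b. if even b then tvar ^ a else 0" n]
  unfolding L_BD_eq L_D_eq[of n] L_D_eq[OF le_SucI] monom_1_eq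
  by (cases n) (auto simp: shift_def fun_eq_iff power_add algebra_simps)

lemma L_BD_Suc: "1 \<le> n \<Longrightarrow> L_BD (Suc n) = L_BD n + tvar ^ (2 * n) * L_D n +
    tvar * geo n * (1 + tvar ^ (2 * n - 2)) * inv_rec (\<lambda>a b. if odd b then tvar ^ a else 0) (n - 1)"
  using inv_rec_Suc_graded[of "\<lambda>a b. if odd b then tvar ^ a else 0" tvar
      "\<lambda>a b. if even b then tvar ^ a else 0" "\<lambda>a b. if odd b then tvar ^ a else 0" n]
  unfolding L_BD_eq L_D_eq[of n] monom_1_eq
  by (cases n) (auto simp: shift_def fun_eq_iff power_add algebra_simps)

text \<open>The quotients in the recursions are really polynomials, so the claims in the fraction
  field reduce to identities of integer polynomials.\<close>

lemma Fract_mult_to_fract: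
  "q \<noteq> 0 \<Longrightarrow> p = q * g \<Longrightarrow> Fract p q * to_fract c = to_fract (g * c)"
  by (simp add: Fract_conv_to_fract)

lemma tvar_square_ne: "tvar ^ 2 - 1 \<noteq> (0 :: int poly)"
  by (simp add: power2_eq_square one_pCons)

lemma geo_eq: "tvar ^ (2 * n) - 1 = (tvar ^ 2 - 1) * geo n"
  using power_diff_1_eq[of "tvar\<^sup>2" n] by (simp add: power_mult)

theorem corollary4p1:
  shows
   "(L_A 1 = 1 + tvar \<and>
     L_A 2 = 1 + 2 * tvar + tvar ^ 3 \<and>
     (\<forall>n\<ge>3. to_fract (L_A n) =
        to_fract (L_A (n - 1))
        + Fract (tvar * (tvar ^ (2 * n) - 1)) (tvar ^ 2 - 1) * to_fract (L_A (n - 2))))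
    \<and>
    (L_B 1 = 1 + tvar \<and>
     L_B 2 = 1 + 2 * tvar + 2 * tvar ^ 3 + tvar ^ 4 \<and>
     (\<forall>n\<ge>3. to_fract (L_B n) =
        to_fract ((1 + tvar ^ (2 * n - 1)) * L_B (n - 1))
        + Fract (tvar * (tvar ^ (4 * n - 4) - 1)) (tvar ^ 2 - 1) * to_fract (L_B (n - 2))))
    \<and>
    (L_D 1 = 1 \<and>
     L_BD 1 = 1 \<and>
     L_D 2 = 1 + 2 * tvar + tvar ^ 2 \<and>
     L_BD 2 = 1 + tvar ^ 2 \<and>
     (\<forall>n\<ge>3. to_fract (L_D n) =
        to_fract (L_D (n - 1) + tvar ^ (2 * n - 2) * L_BD (n - 1))
        + Fract (tvar * (1 + tvar ^ (2 * n - 4)) * (tvar ^ (2 * n - 2) - 1)) (tvar ^ 2 - 1)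
          * to_fract (L_D (n - 2))) \<and>
     (\<forall>n\<ge>3. to_fract (L_BD n) =
        to_fract (L_BD (n - 1) + tvar ^ (2 * n - 2) * L_D (n - 1))
        + Fract (tvar * (1 + tvar ^ (2 * n - 4)) * (tvar ^ (2 * n - 2) - 1)) (tvar ^ 2 - 1)
          * to_fract (L_BD (n - 2))))"
proof (intro conjI allI impI)
  have geo2: "geo 2 = 1 + tvar ^ 2" by (simp add: numeral_2_eq_2)
  \<comment> \<open>The trivial group Sym(1) starts \<open>L_A_Suc\<close> one step below the first
    stated case.\<close>
  have A0: "L_A 0 = 1" unfolding L_A_eq by (simp add: shift_def one_pCons monom_0)
  show A1: "L_A 1 = 1 + tvar"
    using L_A_Suc[of 0] A0 by simp
  show "L_A 2 = 1 + 2 * tvar + tvar ^ 3"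
  proof -
    have "L_A 2 = (1 + tvar) + tvar * geo 2"
      using L_A_Suc[of 1] A1 by (simp add: numeral_2_eq_2 shift_def)
    also have "\<dots> = 1 + 2 * tvar + tvar ^ 3" using geo2 by algebra
    finally show ?thesis .
  qed
  show B1: "L_B 1 = 1 + tvar"
    by (simp add: L_B_eq monom_1_eq shift_def)
  show "L_B 2 = 1 + 2 * tvar + 2 * tvar ^ 3 + tvar ^ 4"
  proof -
    have "L_B 2 = (1 + tvar ^ 3) * (1 + tvar) + tvar * (1 + tvar ^ 2)"
      using L_B_Suc[of 1] B1 by (simp add: numeral_2_eq_2 numeral_3_eq_3)
    also have "\<dots> = 1 + 2 * tvar + 2 * tvar ^ 3 + tvar ^ 4" by algebra
    finally show ?thesis .
  qed
  show D1: "L_D 1 = 1" and BD1: "L_BD 1 = 1"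
    by (simp_all add: L_D_eq L_BD_eq monom_1_eq shift_def)
  show "L_D 2 = 1 + 2 * tvar + tvar ^ 2"
  proof -
    have "L_D 2 = 1 + tvar ^ 2 + tvar * (1 + 1)"
      using L_D_Suc[of 1] D1 BD1 by (simp add: numeral_2_eq_2)
    also have "\<dots> = 1 + 2 * tvar + tvar ^ 2" by algebra
    finally show ?thesis .
  qed
  show "L_BD 2 = 1 + tvar ^ 2"
    using L_BD_Suc[of 1] D1 BD1 by (simp add: numeral_2_eq_2)
next
  fix n :: nat assume n: "3 \<le> n"
  \<comment> \<open>As k is at least 1, \<open>L_B_eq\<close> and \<open>L_D_eq\<close> apply at k
    and identify the remaining \<open>inv_rec\<close> factors.\<close>
  define k where "k = n - 2"
  have k: "n = Suc (Suc k)" "1 \<le> k" using n by (auto simp: k_def)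
  have n_eqs: "n - 1 = Suc k" "n - 2 = k" "2 * n - 1 = 2 * Suc k + 1" "2 * n - 2 = 2 * Suc k"
      "2 * n - 4 = 2 * Suc k - 2" "4 * n - 4 = 2 * (2 * Suc k)"
    using k by auto
  note Fr = Fract_mult_to_fract[OF tvar_square_ne]
  show "to_fract (L_A n) = to_fract (L_A (n - 1))
      + Fract (tvar * (tvar ^ (2 * n) - 1)) (tvar ^ 2 - 1) * to_fract (L_A (n - 2))"
  proof -
    have "tvar * (tvar ^ (2 * n) - 1) = (tvar ^ 2 - 1) * (tvar * geo n)"
      unfolding geo_eq by (simp only: ac_simps)
    note Fr = Fr[OF this]
    have "L_A n = L_A (n - 1) + tvar * geo n * L_A (n - 2)"
      unfolding n_eqs unfolding k(1) L_A_Suc by (simp only: L_A_eq monom_1_eq Suc_eq_plus1)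
    then show ?thesis unfolding Fr by (simp only: to_fract_add)
  qed
  show "to_fract (L_B n) = to_fract ((1 + tvar ^ (2 * n - 1)) * L_B (n - 1))
      + Fract (tvar * (tvar ^ (4 * n - 4) - 1)) (tvar ^ 2 - 1) * to_fract (L_B (n - 2))"
  proof -
    \<comment> \<open>A difference of squares: one factor supplies the geometric sum, the other is
      the factor produced by the two signs of k.\<close>
    have "tvar ^ (4 * n - 4) - 1 = (tvar ^ (2 * Suc k) - 1) * (1 + tvar ^ (2 * Suc k))"
      unfolding n_eqs mult_2[of "2 * Suc k"] power_add by algebra
    then have "tvar * (tvar ^ (4 * n - 4) - 1) =
        (tvar ^ 2 - 1) * (tvar * geo (Suc k) * (1 + tvar ^ (2 * Suc k)))"
      unfolding geo_eq by (simp only: ac_simps)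
    note Fr = Fr[OF this]
    have "L_B n = (1 + tvar ^ (2 * n - 1)) * L_B (n - 1) +
        tvar * geo (Suc k) * (1 + tvar ^ (2 * Suc k)) * L_B (n - 2)"
      using L_B_Suc[of "Suc k"] unfolding n_eqs unfolding k(1) L_B_eq[OF k(2)] monom_1_eq by simp
    then show ?thesis unfolding Fr by (simp only: to_fract_add)
  qed
  have D: "tvar * (1 + tvar ^ (2 * n - 4)) * (tvar ^ (2 * n - 2) - 1) =
      (tvar ^ 2 - 1) * (tvar * geo (Suc k) * (1 + tvar ^ (2 * Suc k - 2)))"
    unfolding n_eqs geo_eq by (simp only: ac_simps)
  note Fr = Fr[OF D]
  show "to_fract (L_D n) = to_fract (L_D (n - 1) + tvar ^ (2 * n - 2) * L_BD (n - 1))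
      + Fract (tvar * (1 + tvar ^ (2 * n - 4)) * (tvar ^ (2 * n - 2) - 1)) (tvar ^ 2 - 1)
          * to_fract (L_D (n - 2))"
  proof -
    have "L_D n = L_D (n - 1) + tvar ^ (2 * n - 2) * L_BD (n - 1) +
        tvar * geo (Suc k) * (1 + tvar ^ (2 * Suc k - 2)) * L_D (n - 2)"
      using L_D_Suc[of "Suc k"] unfolding n_eqs unfolding k(1) L_D_eq[OF k(2)] monom_1_eq by simp
    then show ?thesis unfolding Fr by (simp only: to_fract_add)
  qed
  show "to_fract (L_BD n) = to_fract (L_BD (n - 1) + tvar ^ (2 * n - 2) * L_D (n - 1))
      + Fract (tvar * (1 + tvar ^ (2 * n - 4)) * (tvar ^ (2 * n - 2) - 1)) (tvar ^ 2 - 1)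
          * to_fract (L_BD (n - 2))"
  proof -
    have "L_BD n = L_BD (n - 1) + tvar ^ (2 * n - 2) * L_D (n - 1) +
        tvar * geo (Suc k) * (1 + tvar ^ (2 * Suc k - 2)) * L_BD (n - 2)"
      using L_BD_Suc[of "Suc k"] unfolding n_eqs unfolding k(1) L_BD_eq[of k] monom_1_eq by simp
    then show ?thesis unfolding Fr by (simp only: to_fract_add)
  qed
qed

end
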